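(* Let $(\mathfrak{E},h)=(E,\Phi,h)$ be a hermitian Higgs bundle over a compact Kähler manifold $M$ and $\mathcal{D}_h=D_h+\Phi+\bar\Phi_h$ its Hitchin-Simpson connection. Let $\mathfrak{S}=(S,\Phi|_S)\subset\mathfrak{E}$ be a Higgs subbundle that is $\bar\Phi_h$-invariant. Let $\mathcal{A}_h\in A^1(\mathrm{Hom}(S,S^{\perp}))$ be the second fundamental form of $\mathfrak{S}$ in $(\mathfrak{E},h)$, i.e. the $S^{\perp}$-component of $\mathcal{D}_h$ on sections of $S$: for $\xi\in A^0(S)$, $$\mathcal{D}_h\xi=\mathcal{D}_{h,S}\xi+\mathcal{A}_h\xi,\qquad \mathcal{D}_{h,S}\xi\in A^1(S),\quad \mathcal{A}_h\xi\in A^1(S^{\perp}).$$ Then $\mathcal{A}_h$ vanishes identically if and only if $\mathfrak{E}=\mathfrak{S}\oplus\mathfrak{S}^{\perp}$ is a Higgs orthogonal decomposition, where $\mathfrak{S}^{\perp}=(S^{\perp},\Phi|_{S^{\perp}})$.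
   Context: $M$ is a compact Kähler manifold with holomorphic cotangent bundle $\Omega^{1,0}$ and complex conjugate bundle $\Omega^{0,1}$. For a $C^\infty$ complex vector bundle $V$ over $M$, $A^s(V)$ (resp. $A^{p,q}(V)$) is the space of $C^\infty$ complex $s$-forms (resp. $(p,q)$-forms) on $M$ with values in $V$. A Higgs bundle $\mathfrak{E}=(E,\Phi)$ over $M$ is a holomorphic vector bundle $E$ with a holomorphic $\Phi\in A^{1,0}(\mathrm{End}\,E)$ (the Higgs field) satisfying $\Phi\wedge\Phi=0$. A hermitian Higgs bundle $(\mathfrak{E},h)=(E,\Phi,h)$ is a Higgs bundle with a hermitian metric $h$ in $E$. $D_h$ is the Chern connection of $(E,h)$ and $\bar\Phi_h\in A^{0,1}(\mathrm{End}\,E)$ is the hermitian conjugate of $\Phi$ with respect to $h$, i.e. $h(\bar\Phi_h\xi,\eta)=h(\xi,\Phi\eta)$ for all sections $\xi,\eta$ of $E$. A Higgs subbundle of $\mathfrak{E}$ is a holomorphic subbundle $F\subset E$ that is $\Phi$-invariant ($\Phi(F)\subset F\otimes\Omega^{1,0}$), regarded as the Higgs bundle $(F,\Phi|_F)$; it is $\bar\Phi_h$-invariant if $\bar\Phi_h(F)\subset F\otimes\Omega^{0,1}$. $S^{\perp}$ is the orthogonal complement of $S$ with respect to $h$, a $C^\infty$ complex subbundle of $E$; it is $\Phi$-invariant because $S$ is $\bar\Phi_h$-invariant. In terms of the decomposition $D_h\xi=D_{h,S}\xi+A_h\xi$ ($\xi\in A^0(S)$, $D_{h,S}\xi\in A^1(S)$,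 $A_h\xi\in A^1(S^{\perp})$), one has $\mathcal{D}_{h,S}=D_{h,S}+\Phi|_S+P_S\bar\Phi_h|_S$ and $\mathcal{A}_h=A_h+P_{S^{\perp}}\bar\Phi_h|_S$, with $P_S,P_{S^{\perp}}$ the orthogonal projections. A Higgs orthogonal decomposition $\mathfrak{E}=\mathfrak{S}\oplus\mathfrak{S}^{\perp}$ is a holomorphic direct sum decomposition $E=S\oplus S^{\perp}$, orthogonal with respect to $h$, in which both summands are Higgs subbundles of $\mathfrak{E}$ (in particular $S^{\perp}$ is a holomorphic subbundle of $E$). *)

theory Defs
  imports "HOL-Analysis.Analysis"
begin

section \<open>Smooth and holomorphic functions of several variables\<close>

text \<open>\<open>S\<close> is meant to be open; the domain is finite-dimensional in all uses, so that these
  iterated directional derivatives describe the usual classes \<open>C\<^sup>k\<close> and \<open>C\<^sup>\<infinity>\<close>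
  (in the real sense).\<close>

primrec Ck_on :: "nat \<Rightarrow> ('a::real_normed_vector \<Rightarrow> 'b::real_normed_vector) \<Rightarrow> 'a set \<Rightarrow> bool" where
  "Ck_on 0 f S \<longleftrightarrow> continuous_on S f"
| "Ck_on (Suc k) f S \<longleftrightarrow>
     f differentiable_on S \<and> (\<forall>v. Ck_on k (\<lambda>x. frechet_derivative f (at x) v) S)"

definition smooth_on :: "('a::real_normed_vector \<Rightarrow> 'b::real_normed_vector) \<Rightarrow> 'a set \<Rightarrow> bool" where
  "smooth_on f S \<longleftrightarrow> (\<forall>k. Ck_on k f S)"

text \<open>Holomorphic: \<open>C\<^sup>\<infinity>\<close> and solving the Cauchy--Riemann equations, i.e. the real
  derivative is complex linear.\<close>

definition holo_on :: "(complex^'n \<Rightarrow> complex) \<Rightarrow> (complex^'n) set \<Rightarrow> bool" where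
  "holo_on f S \<longleftrightarrow> smooth_on f S \<and>
     (\<forall>x\<in>S. \<forall>v. frechet_derivative f (at x) (\<i> *s v) = \<i> * frechet_derivative f (at x) v)"


section \<open>Complex manifolds\<close>

text \<open>The manifold is the whole topological space \<open>'m\<close>. A chart is a pair of its domain and
  the coordinate map; the values of the map outside the domain are irrelevant.\<close>

type_synonym ('m, 'n) chart = "'m set \<times> ('m \<Rightarrow> complex^'n)"

definition chart_inv :: "('m, 'n) chart \<Rightarrow> complex^'n \<Rightarrow> 'm" where
  "chart_inv c = inv_into (fst c) (snd c)"

definition complex_atlas :: "('m::topological_space, 'n::finite) chart set \<Rightarrow> bool" where
  "complex_atlas A \<longleftrightarrow>
     (\<Union>c\<in>A. fst c) = UNIV \<and>
     (\<forall>c\<in>A. open (fst c) \<and> open (snd c ` fst c) \<and>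
             homeomorphism (fst c) (snd c ` fst c) (snd c) (chart_inv c)) \<and>
     (\<forall>c\<in>A. \<forall>c'\<in>A. \<forall>i.
        holo_on (\<lambda>x. snd c' (chart_inv c x) $ i) (snd c ` (fst c \<inter> fst c')))"

definition msmooth ::
  "('m, 'n::finite) chart set \<Rightarrow> 'm set \<Rightarrow> ('m \<Rightarrow> 'b::real_normed_vector) \<Rightarrow> bool" where
  "msmooth A U f \<longleftrightarrow> (\<forall>c\<in>A. smooth_on (f \<circ> chart_inv c) (snd c ` (U \<inter> fst c)))"

definition mholo :: "('m, 'n::finite) chart set \<Rightarrow> 'm set \<Rightarrow> ('m \<Rightarrow> complex) \<Rightarrow> bool" where
  "mholo A U f \<longleftrightarrow> (\<forall>c\<in>A. holo_on (f \<circ> chart_inv c) (snd c ` (U \<inter> fst c)))"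

text \<open>A (real) tangent vector at \<open>p\<close> is given by its components in all charts around \<open>p\<close>,
  which are related by the derivatives of the coordinate changes; at charts not around \<open>p\<close>
  the components are set to \<open>0\<close>. Since the coordinate changes are holomorphic,
  \<open>tscale \<i>\<close> is the complex structure of the tangent space.\<close>

type_synonym ('m, 'n) tvec = "('m, 'n) chart \<Rightarrow> complex^'n"

definition tangent_space :: "('m, 'n::finite) chart set \<Rightarrow> 'm \<Rightarrow> ('m, 'n) tvec set" where
  "tangent_space A p = {X.
     (\<forall>c. \<not> (c \<in> A \<and> p \<in> fst c) \<longrightarrow> X c = 0) \<and>
     (\<forall>c\<in>A. \<forall>c'\<in>A. p \<in> fst c \<inter> fst c' \<longrightarrow>
        X c' = frechet_derivative (snd c' \<circ> chart_inv c) (at (snd c p)) (X c))}"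

definition tadd :: "('m, 'n::finite) tvec \<Rightarrow> ('m, 'n) tvec \<Rightarrow> ('m, 'n) tvec" where
  "tadd X Y = (\<lambda>c. X c + Y c)"

definition tscale :: "complex \<Rightarrow> ('m, 'n::finite) tvec \<Rightarrow> ('m, 'n) tvec" where
  "tscale a X = (\<lambda>c. a *s X c)"

text \<open>The tangent vector at \<open>p\<close> with components \<open>v\<close> in the chart \<open>c\<close>; for fixed \<open>v\<close>, as a
  function of \<open>p\<close>, a constant-coefficient coordinate vector field.\<close>

definition coord_vec ::
  "('m, 'n::finite) chart set \<Rightarrow> ('m, 'n) chart \<Rightarrow> complex^'n \<Rightarrow> 'm \<Rightarrow> ('m, 'n) tvec" where
  "coord_vec A c v p = (\<lambda>c'. if c' \<in> A \<and> p \<in> fst c'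
     then frechet_derivative (snd c' \<circ> chart_inv c) (at (snd c p)) v else 0)"

text \<open>By the chain rule, the choice of the chart does not matter.\<close>

definition mdiff ::
  "('m, 'n::finite) chart set \<Rightarrow> ('m \<Rightarrow> 'b::real_normed_vector) \<Rightarrow> 'm \<Rightarrow> ('m, 'n) tvec \<Rightarrow> 'b" where
  "mdiff A f p X = (let c = (SOME c. c \<in> A \<and> p \<in> fst c)
     in frechet_derivative (f \<circ> chart_inv c) (at (snd c p)) (X c))"

text \<open>The \<open>(0,1)\<close>-part of the differential of a function, evaluated on real tangent vectors.\<close>

definition mdbar ::
  "('m, 'n::finite) chart set \<Rightarrow> ('m \<Rightarrow> complex) \<Rightarrow> 'm \<Rightarrow> ('m, 'n) tvec \<Rightarrow> complex" where
  "mdbar A f p X = (mdiff A f p X + \<i> * mdiff A f p (tscale \<i> X)) / 2"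

text \<open>The last conjunct is \<open>d\<omega> = 0\<close> for the fundamental form \<open>\<omega>(X, Y) = g(JX, Y)\<close>, evaluated
  on coordinate vector fields (whose Lie brackets vanish).\<close>

definition kaehler_metric ::
  "('m, 'n::finite) chart set \<Rightarrow> ('m \<Rightarrow> ('m, 'n) tvec \<Rightarrow> ('m, 'n) tvec \<Rightarrow> real) \<Rightarrow> bool" where
  "kaehler_metric A g \<longleftrightarrow>
     (\<forall>p. \<forall>X\<in>tangent_space A p. \<forall>Y\<in>tangent_space A p.
        (\<forall>Z\<in>tangent_space A p. g p (tadd X Y) Z = g p X Z + g p Y Z) \<and>
        (\<forall>a. g p (tscale (complex_of_real a) X) Y = a * g p X Y) \<and>
        g p X Y = g p Y X \<and>
        (X \<noteq> (\<lambda>_. 0) \<longrightarrow> g p X X > 0) \<and>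
        g p (tscale \<i> X) (tscale \<i> Y) = g p X Y) \<and>
     (\<forall>c\<in>A. \<forall>u v. msmooth A (fst c) (\<lambda>p. g p (coord_vec A c u p) (coord_vec A c v p))) \<and>
     (\<forall>c\<in>A. \<forall>p\<in>fst c. \<forall>u v w.
        (let \<omega> = (\<lambda>a b q. g q (tscale \<i> (coord_vec A c a q)) (coord_vec A c b q))
         in mdiff A (\<omega> v w) p (coord_vec A c u p)
          + mdiff A (\<omega> w u) p (coord_vec A c v p)
          + mdiff A (\<omega> u v) p (coord_vec A c w p) = 0))"

definition compact_kaehler_manifold ::
  "('m::t2_space, 'n::finite) chart set \<Rightarrow>
   ('m \<Rightarrow> ('m, 'n) tvec \<Rightarrow> ('m, 'n) tvec \<Rightarrow> real) \<Rightarrow> bool" where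
  "compact_kaehler_manifold A g \<longleftrightarrow>
     compact (UNIV :: 'm set) \<and> complex_atlas A \<and> kaehler_metric A g"


section \<open>Holomorphic vector bundles\<close>

text \<open>The fibres are complex subspaces of one ambient complex vector space (without topology),
  for instance of the direct sum of all fibres. The holomorphic structure (and with it the
  topology of the total space) is given by an atlas of local trivialisations, which are
  fibrewise linear isomorphisms onto \<open>\<complex>\<^sup>r\<close> with holomorphic transition matrices. Vectors of
  \<open>\<complex>\<^sup>r\<close> are represented as sequences vanishing from index \<open>r\<close> on.\<close>

record ('m, 'v) vbundle =
  scale :: "complex \<Rightarrow> 'v \<Rightarrow> 'v"
  fibre :: "'m \<Rightarrow> 'v set"
  bundle_rank :: nat
  trivs :: "('m set \<times> ('m \<Rightarrow> 'v \<Rightarrow> nat \<Rightarrow> complex)) set"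

definition coord_space :: "nat \<Rightarrow> (nat \<Rightarrow> complex) set" where
  "coord_space r = {x. \<forall>i\<ge>r. x i = 0}"

definition local_triv ::
  "('m::topological_space, 'v::ab_group_add) vbundle \<Rightarrow>
   'm set \<times> ('m \<Rightarrow> 'v \<Rightarrow> nat \<Rightarrow> complex) \<Rightarrow> bool" where
  "local_triv B \<tau> \<longleftrightarrow> open (fst \<tau>) \<and>
     (\<forall>p\<in>fst \<tau>.
        bij_betw (snd \<tau> p) (fibre B p) (coord_space (bundle_rank B)) \<and>
        (\<forall>v\<in>fibre B p. \<forall>i.
           (\<forall>w\<in>fibre B p. snd \<tau> p (v + w) i = snd \<tau> p v i + snd \<tau> p w i) \<and>
           (\<forall>a. snd \<tau> p (scale B a v) i = a * snd \<tau> p v i)))"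

definition triv_frame ::
  "('m, 'v) vbundle \<Rightarrow> 'm set \<times> ('m \<Rightarrow> 'v \<Rightarrow> nat \<Rightarrow> complex) \<Rightarrow> nat \<Rightarrow> 'm \<Rightarrow> 'v" where
  "triv_frame B \<tau> j p = inv_into (fibre B p) (snd \<tau> p) (\<lambda>i. if i = j then 1 else 0)"

definition holo_transition ::
  "('m, 'n::finite) chart set \<Rightarrow> ('m, 'v) vbundle \<Rightarrow>
   'm set \<times> ('m \<Rightarrow> 'v \<Rightarrow> nat \<Rightarrow> complex) \<Rightarrow> 'm set \<times> ('m \<Rightarrow> 'v \<Rightarrow> nat \<Rightarrow> complex) \<Rightarrow> bool" where
  "holo_transition A B \<tau> \<tau>' \<longleftrightarrow>
     (\<forall>i<bundle_rank B. \<forall>j<bundle_rank B.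
        mholo A (fst \<tau> \<inter> fst \<tau>') (\<lambda>p. snd \<tau>' p (triv_frame B \<tau> j p) i))"

definition holo_vector_bundle ::
  "('m::topological_space, 'n::finite) chart set \<Rightarrow> ('m, 'v::ab_group_add) vbundle \<Rightarrow> bool" where
  "holo_vector_bundle A B \<longleftrightarrow>
     vector_space (scale B) \<and>
     (\<forall>p. module.subspace (scale B) (fibre B p)) \<and>
     (\<Union>\<tau>\<in>trivs B. fst \<tau>) = UNIV \<and>
     (\<forall>\<tau>\<in>trivs B. local_triv B \<tau>) \<and>
     (\<forall>\<tau>\<in>trivs B. \<forall>\<tau>'\<in>trivs B. holo_transition A B \<tau> \<tau>')"

text \<open>The members of the maximal atlas.\<close>

definition holo_triv ::
  "('m::topological_space, 'n::finite) chart set \<Rightarrow> ('m, 'v::ab_group_add) vbundle \<Rightarrow>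
   'm set \<times> ('m \<Rightarrow> 'v \<Rightarrow> nat \<Rightarrow> complex) \<Rightarrow> bool" where
  "holo_triv A B \<tau> \<longleftrightarrow> local_triv B \<tau> \<and>
     (\<forall>\<tau>'\<in>trivs B. holo_transition A B \<tau> \<tau>' \<and> holo_transition A B \<tau>' \<tau>)"

definition smooth_section ::
  "('m, 'n::finite) chart set \<Rightarrow> ('m, 'v) vbundle \<Rightarrow> 'm set \<Rightarrow> ('m \<Rightarrow> 'v) \<Rightarrow> bool" where
  "smooth_section A B U \<xi> \<longleftrightarrow>
     (\<forall>p\<in>U. \<xi> p \<in> fibre B p) \<and>
     (\<forall>\<tau>\<in>trivs B. \<forall>i<bundle_rank B. msmooth A (U \<inter> fst \<tau>) (\<lambda>p. snd \<tau> p (\<xi> p) i))"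

definition holo_section ::
  "('m, 'n::finite) chart set \<Rightarrow> ('m, 'v) vbundle \<Rightarrow> 'm set \<Rightarrow> ('m \<Rightarrow> 'v) \<Rightarrow> bool" where
  "holo_section A B U \<xi> \<longleftrightarrow>
     (\<forall>p\<in>U. \<xi> p \<in> fibre B p) \<and>
     (\<forall>\<tau>\<in>trivs B. \<forall>i<bundle_rank B. mholo A (U \<inter> fst \<tau>) (\<lambda>p. snd \<tau> p (\<xi> p) i))"

definition holo_subbundle ::
  "('m::topological_space, 'n::finite) chart set \<Rightarrow> ('m, 'v::ab_group_add) vbundle \<Rightarrow>
   ('m \<Rightarrow> 'v set) \<Rightarrow> bool" where
  "holo_subbundle A B S \<longleftrightarrow>
     (\<forall>p. S p \<subseteq> fibre B p \<and> module.subspace (scale B) (S p)) \<and>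
     (\<exists>k\<le>bundle_rank B. \<forall>p. \<exists>\<tau>. p \<in> fst \<tau> \<and> holo_triv A B \<tau> \<and>
        (\<forall>q\<in>fst \<tau>. snd \<tau> q ` S q = coord_space k))"


section \<open>Bundle-valued forms\<close>

text \<open>A complex 1-form with values in a complex bundle is identified with its restriction to
  real tangent vectors, an arbitrary real-linear map from the tangent space to the fibre. It has
  type \<open>(1,0)\<close> (resp. \<open>(0,1)\<close>) iff this map is complex linear (resp. antilinear).\<close>

definition smooth_form1 ::
  "('m, 'n::finite) chart set \<Rightarrow> ('m, 'v::ab_group_add) vbundle \<Rightarrow> 'm set \<Rightarrow>
   ('m \<Rightarrow> ('m, 'n) tvec \<Rightarrow> 'v) \<Rightarrow> bool" where
  "smooth_form1 A B U \<omega> \<longleftrightarrow>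
     (\<forall>p\<in>U. \<forall>X\<in>tangent_space A p.
        \<omega> p X \<in> fibre B p \<and>
        (\<forall>Y\<in>tangent_space A p. \<omega> p (tadd X Y) = \<omega> p X + \<omega> p Y) \<and>
        (\<forall>a. \<omega> p (tscale (complex_of_real a) X) = scale B (complex_of_real a) (\<omega> p X))) \<and>
     (\<forall>c\<in>A. \<forall>v. smooth_section A B (U \<inter> fst c) (\<lambda>p. \<omega> p (coord_vec A c v p)))"

text \<open>1-forms with values in \<open>Hom(S, S')\<close> for smooth subbundles \<open>S\<close>, \<open>S'\<close> of \<open>B\<close>; such a form
  is smooth iff it maps smooth sections of \<open>S\<close> to smooth 1-forms.\<close>

definition hom_form1 ::
  "('m::topological_space, 'n::finite) chart set \<Rightarrow> ('m, 'v::ab_group_add) vbundle \<Rightarrow>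
   ('m \<Rightarrow> 'v set) \<Rightarrow> ('m \<Rightarrow> 'v set) \<Rightarrow> ('m \<Rightarrow> ('m, 'n) tvec \<Rightarrow> 'v \<Rightarrow> 'v) \<Rightarrow> bool" where
  "hom_form1 A B S S' \<Theta> \<longleftrightarrow>
     (\<forall>p. \<forall>X\<in>tangent_space A p. \<forall>s\<in>S p.
        \<Theta> p X s \<in> S' p \<and>
        (\<forall>s'\<in>S p. \<Theta> p X (s + s') = \<Theta> p X s + \<Theta> p X s') \<and>
        (\<forall>a. \<Theta> p X (scale B a s) = scale B a (\<Theta> p X s)) \<and>
        (\<forall>Y\<in>tangent_space A p. \<Theta> p (tadd X Y) s = \<Theta> p X s + \<Theta> p Y s) \<and>
        (\<forall>a. \<Theta> p (tscale (complex_of_real a) X) s = scale B (complex_of_real a) (\<Theta> p X s))) \<and>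
     (\<forall>U \<xi>. open U \<longrightarrow> smooth_section A B U \<xi> \<longrightarrow> (\<forall>p\<in>U. \<xi> p \<in> S p) \<longrightarrow>
        smooth_form1 A B U (\<lambda>p X. \<Theta> p X (\<xi> p)))"


section \<open>Hermitian Higgs bundles\<close>

text \<open>The third conjunct says that \<open>\<Phi>\<close> is of type \<open>(1,0)\<close>, the fourth that it is holomorphic, and
  the last one is \<open>\<Phi> \<and> \<Phi> = 0\<close>.\<close>

definition higgs_bundle ::
  "('m::topological_space, 'n::finite) chart set \<Rightarrow> ('m, 'v::ab_group_add) vbundle \<Rightarrow>
   ('m \<Rightarrow> ('m, 'n) tvec \<Rightarrow> 'v \<Rightarrow> 'v) \<Rightarrow> bool" where
  "higgs_bundle A B \<Phi> \<longleftrightarrow>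
     holo_vector_bundle A B \<and>
     hom_form1 A B (fibre B) (fibre B) \<Phi> \<and>
     (\<forall>p. \<forall>X\<in>tangent_space A p. \<forall>v\<in>fibre B p. \<Phi> p (tscale \<i> X) v = scale B \<i> (\<Phi> p X v)) \<and>
     (\<forall>U s. open U \<longrightarrow> holo_section A B U s \<longrightarrow>
        (\<forall>c\<in>A. \<forall>u. holo_section A B (U \<inter> fst c) (\<lambda>p. \<Phi> p (coord_vec A c u p) (s p)))) \<and>
     (\<forall>p. \<forall>X\<in>tangent_space A p. \<forall>Y\<in>tangent_space A p. \<forall>v\<in>fibre B p.
        \<Phi> p X (\<Phi> p Y v) - \<Phi> p Y (\<Phi> p X v) = 0)"

text \<open>Hermitian metrics are linear in the first argument.\<close>

definition hermitian_metric ::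
  "('m::topological_space, 'n::finite) chart set \<Rightarrow> ('m, 'v::ab_group_add) vbundle \<Rightarrow>
   ('m \<Rightarrow> 'v \<Rightarrow> 'v \<Rightarrow> complex) \<Rightarrow> bool" where
  "hermitian_metric A B h \<longleftrightarrow>
     (\<forall>p. \<forall>v\<in>fibre B p. \<forall>w\<in>fibre B p.
        (\<forall>u\<in>fibre B p. h p (v + w) u = h p v u + h p w u) \<and>
        (\<forall>a. h p (scale B a v) w = a * h p v w) \<and>
        h p w v = cnj (h p v w) \<and>
        (v \<noteq> 0 \<longrightarrow> Re (h p v v) > 0)) \<and>
     (\<forall>U \<xi> \<eta>. open U \<longrightarrow> smooth_section A B U \<xi> \<longrightarrow> smooth_section A B U \<eta> \<longrightarrow>
        msmooth A U (\<lambda>p. h p (\<xi> p) (\<eta> p)))"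

definition hermitian_higgs_bundle ::
  "('m::topological_space, 'n::finite) chart set \<Rightarrow> ('m, 'v::ab_group_add) vbundle \<Rightarrow>
   ('m \<Rightarrow> ('m, 'n) tvec \<Rightarrow> 'v \<Rightarrow> 'v) \<Rightarrow> ('m \<Rightarrow> 'v \<Rightarrow> 'v \<Rightarrow> complex) \<Rightarrow> bool" where
  "hermitian_higgs_bundle A B \<Phi> h \<longleftrightarrow> higgs_bundle A B \<Phi> \<and> hermitian_metric A B h"

text \<open>Since forms are evaluated on real tangent vectors, \<open>h(\<Phi>'\<xi>, \<eta>) = h(\<xi>, \<Phi>\<eta>)\<close> needs no
  conjugation of the form part.\<close>

definition hermitian_conjugate ::
  "('m::topological_space, 'n::finite) chart set \<Rightarrow> ('m, 'v::ab_group_add) vbundle \<Rightarrow>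
   ('m \<Rightarrow> 'v \<Rightarrow> 'v \<Rightarrow> complex) \<Rightarrow> ('m \<Rightarrow> ('m, 'n) tvec \<Rightarrow> 'v \<Rightarrow> 'v) \<Rightarrow>
   ('m \<Rightarrow> ('m, 'n) tvec \<Rightarrow> 'v \<Rightarrow> 'v) \<Rightarrow> bool" where
  "hermitian_conjugate A B h \<Phi> \<Phi>' \<longleftrightarrow>
     hom_form1 A B (fibre B) (fibre B) \<Phi>' \<and>
     (\<forall>p. \<forall>X\<in>tangent_space A p. \<forall>v\<in>fibre B p.
        \<Phi>' p (tscale \<i> X) v = scale B (- \<i>) (\<Phi>' p X v)) \<and>
     (\<forall>p. \<forall>X\<in>tangent_space A p. \<forall>v\<in>fibre B p. \<forall>w\<in>fibre B p.
        h p (\<Phi>' p X v) w = h p v (\<Phi> p X w))"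


section \<open>Connections\<close>

text \<open>Connections are morphisms of sheaves: they act on smooth sections over arbitrary open sets,
  compatibly with restriction. Only the values on the relevant open set matter.\<close>

definition connection ::
  "('m::topological_space, 'n::finite) chart set \<Rightarrow> ('m, 'v::ab_group_add) vbundle \<Rightarrow>
   (('m \<Rightarrow> 'v) \<Rightarrow> 'm \<Rightarrow> ('m, 'n) tvec \<Rightarrow> 'v) \<Rightarrow> bool" where
  "connection A B D \<longleftrightarrow> (\<forall>U \<xi>. open U \<longrightarrow> smooth_section A B U \<xi> \<longrightarrow>
     smooth_form1 A B U (D \<xi>) \<and>
     (\<forall>\<eta>. (\<forall>p\<in>U. \<eta> p = \<xi> p) \<longrightarrow> (\<forall>p\<in>U. \<forall>X\<in>tangent_space A p. D \<eta> p X = D \<xi> p X)) \<and>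
     (\<forall>\<eta>. smooth_section A B U \<eta> \<longrightarrow>
        (\<forall>p\<in>U. \<forall>X\<in>tangent_space A p. D (\<lambda>q. \<xi> q + \<eta> q) p X = D \<xi> p X + D \<eta> p X)) \<and>
     (\<forall>f. msmooth A U f \<longrightarrow>
        (\<forall>p\<in>U. \<forall>X\<in>tangent_space A p.
           D (\<lambda>q. scale B (f q) (\<xi> q)) p X =
             scale B (mdiff A f p X) (\<xi> p) + scale B (f p) (D \<xi> p X))))"

text \<open>The operator \<open>\<partial>\<close>-bar of a holomorphic bundle, computed in a local holomorphic frame (the
  result does not depend on the frame).\<close>

definition bundle_dbar ::
  "('m, 'n::finite) chart set \<Rightarrow> ('m, 'v::ab_group_add) vbundle \<Rightarrow>
   ('m \<Rightarrow> 'v) \<Rightarrow> 'm \<Rightarrow> ('m, 'n) tvec \<Rightarrow> 'v" where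
  "bundle_dbar A B \<xi> p X = (let \<tau> = (SOME \<tau>. \<tau> \<in> trivs B \<and> p \<in> fst \<tau>)
     in \<Sum>i<bundle_rank B.
          scale B (mdbar A (\<lambda>q. snd \<tau> q (\<xi> q) i) p X) (triv_frame B \<tau> i p))"

text \<open>The Chern connection is the connection whose \<open>(0,1)\<close>-part is \<open>\<partial>\<close>-bar and which is compatible
  with the metric.\<close>

definition chern_connection ::
  "('m::topological_space, 'n::finite) chart set \<Rightarrow> ('m, 'v::ab_group_add) vbundle \<Rightarrow>
   ('m \<Rightarrow> 'v \<Rightarrow> 'v \<Rightarrow> complex) \<Rightarrow> (('m \<Rightarrow> 'v) \<Rightarrow> 'm \<Rightarrow> ('m, 'n) tvec \<Rightarrow> 'v) \<Rightarrow> bool" where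
  "chern_connection A B h D \<longleftrightarrow>
     connection A B D \<and>
     (\<forall>U \<xi>. open U \<longrightarrow> smooth_section A B U \<xi> \<longrightarrow>
        (\<forall>p\<in>U. \<forall>X\<in>tangent_space A p.
           scale B (1 / 2) (D \<xi> p X + scale B \<i> (D \<xi> p (tscale \<i> X))) = bundle_dbar A B \<xi> p X)) \<and>
     (\<forall>U \<xi> \<eta>. open U \<longrightarrow> smooth_section A B U \<xi> \<longrightarrow> smooth_section A B U \<eta> \<longrightarrow>
        (\<forall>p\<in>U. \<forall>X\<in>tangent_space A p.
           mdiff A (\<lambda>q. h q (\<xi> q) (\<eta> q)) p X = h p (D \<xi> p X) (\<eta> p) + h p (\<xi> p) (D \<eta> p X)))"

definition hitchin_simpson ::
  "(('m \<Rightarrow> 'v::ab_group_add) \<Rightarrow> 'm \<Rightarrow> ('m, 'n::finite) tvec \<Rightarrow> 'v) \<Rightarrow>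
   ('m \<Rightarrow> ('m, 'n) tvec \<Rightarrow> 'v \<Rightarrow> 'v) \<Rightarrow> ('m \<Rightarrow> ('m, 'n) tvec \<Rightarrow> 'v \<Rightarrow> 'v) \<Rightarrow>
   ('m \<Rightarrow> 'v) \<Rightarrow> 'm \<Rightarrow> ('m, 'n) tvec \<Rightarrow> 'v" where
  "hitchin_simpson D \<Phi> \<Phi>' \<xi> p X = D \<xi> p X + \<Phi> p X (\<xi> p) + \<Phi>' p X (\<xi> p)"


section \<open>Higgs subbundles\<close>

definition form_invariant ::
  "('m, 'n::finite) chart set \<Rightarrow> ('m \<Rightarrow> ('m, 'n) tvec \<Rightarrow> 'v \<Rightarrow> 'v) \<Rightarrow> ('m \<Rightarrow> 'v set) \<Rightarrow> bool" where
  "form_invariant A \<Theta> S \<longleftrightarrow> (\<forall>p. \<forall>X\<in>tangent_space A p. \<forall>s\<in>S p. \<Theta> p X s \<in> S p)"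

definition higgs_subbundle ::
  "('m::topological_space, 'n::finite) chart set \<Rightarrow> ('m, 'v::ab_group_add) vbundle \<Rightarrow>
   ('m \<Rightarrow> ('m, 'n) tvec \<Rightarrow> 'v \<Rightarrow> 'v) \<Rightarrow> ('m \<Rightarrow> 'v set) \<Rightarrow> bool" where
  "higgs_subbundle A B \<Phi> S \<longleftrightarrow> holo_subbundle A B S \<and> form_invariant A \<Phi> S"

definition orth_compl ::
  "('m, 'v) vbundle \<Rightarrow> ('m \<Rightarrow> 'v \<Rightarrow> 'v \<Rightarrow> complex) \<Rightarrow> ('m \<Rightarrow> 'v set) \<Rightarrow> 'm \<Rightarrow> 'v set" where
  "orth_compl B h S p = {v \<in> fibre B p. \<forall>s\<in>S p. h p v s = 0}"

text \<open>\<open>DS\<close> and \<open>\<A>\<close> are the two components of \<open>\<D>\<close> on smooth sections of \<open>S\<close>; they are uniquely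
  determined (\<open>DS\<close> on sections of \<open>S\<close>, \<open>\<A>\<close> on \<open>S\<close>).\<close>

definition second_fundamental_form ::
  "('m::topological_space, 'n::finite) chart set \<Rightarrow> ('m, 'v::ab_group_add) vbundle \<Rightarrow>
   ('m \<Rightarrow> 'v \<Rightarrow> 'v \<Rightarrow> complex) \<Rightarrow> (('m \<Rightarrow> 'v) \<Rightarrow> 'm \<Rightarrow> ('m, 'n) tvec \<Rightarrow> 'v) \<Rightarrow> ('m \<Rightarrow> 'v set) \<Rightarrow>
   (('m \<Rightarrow> 'v) \<Rightarrow> 'm \<Rightarrow> ('m, 'n) tvec \<Rightarrow> 'v) \<Rightarrow> ('m \<Rightarrow> ('m, 'n) tvec \<Rightarrow> 'v \<Rightarrow> 'v) \<Rightarrow> bool" where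
  "second_fundamental_form A B h \<D> S DS \<A> \<longleftrightarrow>
     hom_form1 A B S (orth_compl B h S) \<A> \<and>
     (\<forall>U \<xi>. open U \<longrightarrow> smooth_section A B U \<xi> \<longrightarrow> (\<forall>p\<in>U. \<xi> p \<in> S p) \<longrightarrow>
        smooth_form1 A B U (DS \<xi>) \<and>
        (\<forall>p\<in>U. \<forall>X\<in>tangent_space A p.
           DS \<xi> p X \<in> S p \<and> \<D> \<xi> p X = DS \<xi> p X + \<A> p X (\<xi> p)))"

definition higgs_orthogonal_decomposition ::
  "('m::topological_space, 'n::finite) chart set \<Rightarrow> ('m, 'v::ab_group_add) vbundle \<Rightarrow>
   ('m \<Rightarrow> ('m, 'n) tvec \<Rightarrow> 'v \<Rightarrow> 'v) \<Rightarrow> ('m \<Rightarrow> 'v \<Rightarrow> 'v \<Rightarrow> complex) \<Rightarrow>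
   ('m \<Rightarrow> 'v set) \<Rightarrow> ('m \<Rightarrow> 'v set) \<Rightarrow> bool" where
  "higgs_orthogonal_decomposition A B \<Phi> h S S' \<longleftrightarrow>
     higgs_subbundle A B \<Phi> S \<and> higgs_subbundle A B \<Phi> S' \<and>
     (\<forall>p. fibre B p = {s + s' | s s'. s \<in> S p \<and> s' \<in> S' p} \<and> S p \<inter> S' p = {0}) \<and>
     (\<forall>p. \<forall>s\<in>S p. \<forall>s'\<in>S' p. h p s s' = 0)"

end

theory Submission
  imports Defs
begin

text \<open>
  Write \<open>D\<close> for the Chern connection. On sections of \<open>S\<close> the Hitchin--Simpson connection differs from
  \<open>D\<close> by \<open>\<Phi>\<close> and its adjoint, which preserve \<open>S\<close>. Hence the second fundamental form vanishes iff \<open>D\<close>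
  preserves \<open>S\<close>, and, \<open>\<Phi>\<close> preserving the complement too, all that matters is that \<open>D\<close> preserves \<open>S\<close> iff
  the orthogonal complement of \<open>S\<close> is a holomorphic subbundle.

  If the complement is holomorphic, take holomorphic sections \<open>\<xi>\<close> of \<open>S\<close> and \<open>\<eta>\<close> of the complement.
  Differentiating \<open>h(\<xi>, \<eta>) = 0\<close> and separating types gives \<open>h(D\<xi>, \<eta>) = 0\<close>
  (\<open>holo_orth_derivative\<close>), so \<open>D\<xi>\<close> takes values in \<open>S\<close> (\<open>D_frame_in_subbundle\<close>). Since the second
  fundamental form is tensorial, it is enough to treat the members of a holomorphic frame of \<open>S\<close>.

  Conversely, let \<open>D\<close> preserve \<open>S\<close>; then it preserves the complement (\<open>D_orth_compl\<close>). Extend a local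
  holomorphic frame \<open>e\<^sub>i\<close>, \<open>i < k\<close>, of \<open>S\<close> to a holomorphic frame of the bundle, and for \<open>j \<ge> k\<close> subtract
  from \<open>e\<^sub>j\<close> its orthogonal projection \<open>\<Sum>i<k. a i j e\<^sub>i\<close> to \<open>S\<close>. The coefficients are smooth by the
  Gram--Schmidt process (\<open>gram_schmidt\<close>), and they are holomorphic because the \<open>(0,1)\<close>-part of \<open>D e\<^sub>j\<close>
  vanishes and its components in \<open>S\<close> are \<open>\<partial>\<close>-bar of the \<open>a i j\<close>
  (\<open>holo_subbundle_orth_compl\<close>). The differences form a holomorphic frame of the complement, and the
  change of frame is unipotent up to the order of the frame, so that its inverse is explicit (\<open>holo_triv_shear\<close>).
\<close>

section \<open>Algebra of smooth and holomorphic functions\<close>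

lemma Ck_on_cong:
  assumes "open S" "Ck_on k f S" "\<And>x. x \<in> S \<Longrightarrow> f x = g x"
  shows "Ck_on k g S"
  using assms(2,3)
proof (induction k arbitrary: f g)
  case 0
  have "continuous_on S f = continuous_on S g"
    by (rule continuous_on_cong) (simp_all add: 0(2))
  then show ?case using 0(1) by simp
next
  case (Suc k)
  have f: "f differentiable (at x)" if "x \<in> S" for x
    using Suc.prems(1) assms(1) that by (simp add: differentiable_on_eq_differentiable_at)
  have d: "(g has_derivative frechet_derivative f (at x)) (at x)" if "x \<in> S" for x
    by (rule has_derivative_transform_within_open[OF f[OF that, unfolded frechet_derivative_works]
          assms(1) that Suc.prems(2)])
  have "Ck_on k (\<lambda>x. frechet_derivative g (at x) v) S" for v
  proof (rule Suc.IH)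
    show "Ck_on k (\<lambda>x. frechet_derivative f (at x) v) S" using Suc.prems(1) by simp
    show "frechet_derivative f (at x) v = frechet_derivative g (at x) v" if "x \<in> S" for x
      using frechet_derivative_at[OF d[OF that]] by simp
  qed
  moreover have "g differentiable_on S"
    using differentiableI[OF d] assms(1) by (simp add: differentiable_on_eq_differentiable_at)
  ultimately show ?case by simp
qed

lemma Ck_on_subset: "Ck_on k f S \<Longrightarrow> T \<subseteq> S \<Longrightarrow> Ck_on k f T"
proof (induction k arbitrary: f)
  case 0
  then show ?case using continuous_on_subset by simp
next
  case (Suc k)
  then show ?case using differentiable_on_subset[of f S T] by simp
qed

lemma Ck_on_Suc_imp: "Ck_on (Suc k) f S \<Longrightarrow> Ck_on k f S"
proof (induction k arbitrary: f)
  case (Suc k)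
  have "f differentiable_on S" "Ck_on (Suc k) (\<lambda>x. frechet_derivative f (at x) v) S" for v
    using Suc.prems by (simp_all only: Ck_on.simps(2)[of "Suc k" f])
  then show ?case by (simp only: Ck_on.simps(2)[of k f] Suc.IH simp_thms)
qed (simp add: differentiable_imp_continuous_on)

lemma Ck_on_const: "Ck_on k (\<lambda>x. c) S"
  by (induction k arbitrary: c) simp_all

lemma has_derivative_frechet:
  assumes "open S" "f differentiable_on S" "x \<in> S"
  shows "(f has_derivative frechet_derivative f (at x)) (at x)"
  using assms by (simp add: differentiable_on_eq_differentiable_at frechet_derivative_works)

text \<open>It suffices to know the derivative on the open set, by whatever formula; this drives the inductions
  on the order of differentiability below.\<close>

lemma Ck_on_SucI:
  assumes "open S" "\<And>x. x \<in> S \<Longrightarrow> (f has_derivative f' x) (at x)"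
    "\<And>v. Ck_on k (\<lambda>x. f' x v) S"
  shows "Ck_on (Suc k) f S"
proof -
  have "frechet_derivative f (at x) = f' x" if "x \<in> S" for x
    using frechet_derivative_at[OF assms(2)[OF that]] by simp
  then have "Ck_on k (\<lambda>x. frechet_derivative f (at x) v) S" for v
    by (intro Ck_on_cong[OF assms(1) assms(3)]) simp
  moreover have "f differentiable_on S"
    using assms(1,2) by (auto simp: differentiable_on_eq_differentiable_at differentiable_def)
  ultimately show ?thesis by simp
qed

lemma Ck_on_add:
  assumes "open S" "Ck_on k f S" "Ck_on k g S"
  shows "Ck_on k (\<lambda>x. f x + g x) S"
  using assms(2,3)
proof (induction k arbitrary: f g)
  case (Suc k)
  show ?case
  proof (rule Ck_on_SucI[OF assms(1)])
    fix x assume "x \<in> S"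
    then show "((\<lambda>x. f x + g x) has_derivative
        (\<lambda>v. frechet_derivative f (at x) v + frechet_derivative g (at x) v)) (at x)"
      using Suc.prems assms(1) by (intro has_derivative_add has_derivative_frechet) auto
  qed (use Suc in auto)
qed (simp add: continuous_on_add)

lemma Ck_on_mult:
  fixes f g :: "'a::real_normed_vector \<Rightarrow> 'b::real_normed_algebra"
  assumes "open S" "Ck_on k f S" "Ck_on k g S"
  shows "Ck_on k (\<lambda>x. f x * g x) S"
  using assms(2,3)
proof (induction k arbitrary: f g)
  case (Suc k)
  show ?case
  proof (rule Ck_on_SucI[OF assms(1)])
    fix x assume "x \<in> S"
    then show "((\<lambda>x. f x * g x) has_derivative
        (\<lambda>v. f x * frechet_derivative g (at x) v + frechet_derivative f (at x) v * g x)) (at x)"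
      using Suc.prems assms(1) by (intro has_derivative_mult has_derivative_frechet) auto
  next
    fix v
    show "Ck_on k (\<lambda>x. f x * frechet_derivative g (at x) v + frechet_derivative f (at x) v * g x) S"
      using Suc.prems Suc.prems[THEN Ck_on_Suc_imp]
      by (intro Ck_on_add[OF assms(1)] Suc.IH) auto
  qed
qed (simp add: continuous_on_mult)

lemma Ck_on_inverse:
  fixes f :: "'a::real_normed_vector \<Rightarrow> 'b::real_normed_field"
  assumes "open S" "Ck_on k f S" "\<And>x. x \<in> S \<Longrightarrow> f x \<noteq> 0"
  shows "Ck_on k (\<lambda>x. inverse (f x)) S"
  using assms(2)
proof (induction k)
  case (Suc k)
  show ?case
  proof (rule Ck_on_SucI[OF assms(1)])
    fix x assume "x \<in> S"
    then show "((\<lambda>x. inverse (f x)) has_derivative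
        (\<lambda>v. (- 1) * (inverse (f x) * frechet_derivative f (at x) v * inverse (f x)))) (at x)"
      using Deriv.has_derivative_inverse[where f = f and x = x and S = UNIV, OF assms(3) has_derivative_frechet[OF assms(1)]]
        Suc.prems by simp
  next
    fix v
    show "Ck_on k (\<lambda>x. (- 1) * (inverse (f x) * frechet_derivative f (at x) v * inverse (f x))) S"
      using Suc.prems Suc.IH[OF Suc.prems[THEN Ck_on_Suc_imp]]
      by (intro Ck_on_mult[OF assms(1)] Ck_on_const) auto
  qed
qed (use assms(3) in \<open>simp add: continuous_on_inverse\<close>)

lemma smooth_on_subset: "smooth_on f S \<Longrightarrow> T \<subseteq> S \<Longrightarrow> smooth_on f T"
  by (auto simp: smooth_on_def intro: Ck_on_subset)

lemma smooth_on_differentiable_on: "smooth_on f S \<Longrightarrow> f differentiable_on S"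
  unfolding smooth_on_def by (drule spec[of _ "Suc 0"]) simp

lemma holo_onI:
  assumes "open S" "smooth_on f S" "\<And>x. x \<in> S \<Longrightarrow> (f has_derivative f' x) (at x)"
    "\<And>x v. x \<in> S \<Longrightarrow> f' x (\<i> *s v) = \<i> * f' x v"
  shows "holo_on f S"
proof -
  have "frechet_derivative f (at x) = f' x" if "x \<in> S" for x
    using frechet_derivative_at[OF assms(3)[OF that]] by simp
  with assms(2,4) show ?thesis by (simp add: holo_on_def)
qed

lemma holo_on_has_derivative:
  assumes "open S" "holo_on f S" "x \<in> S"
  shows "(f has_derivative frechet_derivative f (at x)) (at x)"
  using assms by (intro has_derivative_frechet[OF assms(1)] smooth_on_differentiable_on) (auto simp: holo_on_def)

lemma holo_on_const: "open S \<Longrightarrow> holo_on (\<lambda>x. c) S"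
  by (rule holo_onI[where f' = "\<lambda>_ _. 0"]) (auto simp: smooth_on_def Ck_on_const)

lemma holo_on_add:
  assumes "open S" "holo_on f S" "holo_on g S"
  shows "holo_on (\<lambda>x. f x + g x) S"
proof (rule holo_onI[OF assms(1)])
  show "smooth_on (\<lambda>x. f x + g x) S"
    using assms by (auto simp: smooth_on_def holo_on_def intro: Ck_on_add)
  show "((\<lambda>x. f x + g x) has_derivative
        (\<lambda>v. frechet_derivative f (at x) v + frechet_derivative g (at x) v)) (at x)" if "x \<in> S" for x
    using assms that by (intro has_derivative_add holo_on_has_derivative)
qed (use assms(2,3) in \<open>auto simp: holo_on_def algebra_simps\<close>)

lemma holo_on_mult:
  assumes "open S" "holo_on f S" "holo_on g S"
  shows "holo_on (\<lambda>x. f x * g x) S"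
proof (rule holo_onI[OF assms(1)])
  show "smooth_on (\<lambda>x. f x * g x) S"
    using assms by (auto simp: smooth_on_def holo_on_def intro: Ck_on_mult)
  show "((\<lambda>x. f x * g x) has_derivative
        (\<lambda>v. f x * frechet_derivative g (at x) v + frechet_derivative f (at x) v * g x)) (at x)"
    if "x \<in> S" for x
    using assms that by (intro has_derivative_mult holo_on_has_derivative)
qed (use assms(2,3) in \<open>auto simp: holo_on_def algebra_simps\<close>)

lemma holo_on_subset: "holo_on f S \<Longrightarrow> T \<subseteq> S \<Longrightarrow> holo_on f T"
  by (auto simp: holo_on_def intro: smooth_on_subset)

section \<open>Functions on a complex manifold\<close>

lemma open_chart_image:
  assumes "complex_atlas A" "c \<in> A" "open U"
  shows "open (snd c ` (U \<inter> fst c))"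
proof -
  have h: "homeomorphism (fst c) (snd c ` fst c) (snd c) (chart_inv c)"
    and o: "open (snd c ` fst c)" "open (fst c)"
    using assms(1,2) unfolding complex_atlas_def by auto
  have "openin (top_of_set (snd c ` fst c)) (snd c ` (U \<inter> fst c))"
    using h assms(3) by (intro homeomorphism_imp_open_map[OF h]) (auto simp: openin_open)
  then show ?thesis using o openin_open_trans by blast
qed

lemma chart_inv_chart:
  assumes "complex_atlas A" "c \<in> A" "p \<in> fst c"
  shows "chart_inv c (snd c p) = p"
proof -
  have "homeomorphism (fst c) (snd c ` fst c) (snd c) (chart_inv c)"
    using assms unfolding complex_atlas_def by blast
  then show ?thesis using assms(3) by (rule homeomorphism_apply1)
qed

lemma msmooth_subset: "msmooth A U f \<Longrightarrow> V \<subseteq> U \<Longrightarrow> msmooth A V f"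
  unfolding msmooth_def by (intro ballI, drule (1) bspec, erule smooth_on_subset) blast

lemma mholo_subset: "mholo A U f \<Longrightarrow> V \<subseteq> U \<Longrightarrow> mholo A V f"
  unfolding mholo_def by (intro ballI, drule (1) bspec, erule holo_on_subset) blast

lemma mholo_imp_msmooth: "mholo A U f \<Longrightarrow> msmooth A U f"
  by (simp add: mholo_def msmooth_def holo_on_def)

context
  fixes A :: "('m::topological_space, 'n::finite) chart set" and U :: "'m set"
  assumes A: "complex_atlas A" and U: "open U"
begin

lemma smooth_on_chart_cong:
  assumes "c \<in> A" "smooth_on (f \<circ> chart_inv c) (snd c ` (U \<inter> fst c))" "\<And>p. p \<in> U \<Longrightarrow> f p = g p"
  shows "smooth_on (g \<circ> chart_inv c) (snd c ` (U \<inter> fst c))"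
  using assms open_chart_image[OF A assms(1) U] chart_inv_chart[OF A assms(1)]
  unfolding smooth_on_def by (auto intro: Ck_on_cong[of _ _ "f \<circ> chart_inv c"])

lemma msmooth_cong:
  assumes "msmooth A U f" "\<And>p. p \<in> U \<Longrightarrow> f p = g p"
  shows "msmooth A U g"
  using assms smooth_on_chart_cong unfolding msmooth_def by blast

lemma mholo_cong:
  assumes f: "mholo A U f" and fg: "\<And>p. p \<in> U \<Longrightarrow> f p = g p"
  shows "mholo A U g"
  unfolding mholo_def
proof
  fix c assume c: "c \<in> A"
  let ?S = "snd c ` (U \<inter> fst c)"
  have h: "holo_on (f \<circ> chart_inv c) ?S" using f c unfolding mholo_def by blast
  have o: "open ?S" using open_chart_image[OF A c U] .
  show "holo_on (g \<circ> chart_inv c) ?S"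
  proof (rule holo_onI[OF o])
    show "smooth_on (g \<circ> chart_inv c) ?S"
      using smooth_on_chart_cong[OF c _ fg] h by (auto simp: holo_on_def)
    show "((g \<circ> chart_inv c) has_derivative frechet_derivative (f \<circ> chart_inv c) (at x)) (at x)"
      if "x \<in> ?S" for x
      using fg chart_inv_chart[OF A c]
      by (intro has_derivative_transform_within_open[OF holo_on_has_derivative[OF o h that] o that]) auto
  qed (use h in \<open>auto simp: holo_on_def\<close>)
qed

lemma msmooth_const: "msmooth A U (\<lambda>p. c)"
  unfolding msmooth_def smooth_on_def comp_def by (auto intro: Ck_on_const)

lemma msmooth_add: "msmooth A U f \<Longrightarrow> msmooth A U g \<Longrightarrow> msmooth A U (\<lambda>p. f p + g p)"
  unfolding msmooth_def smooth_on_def comp_def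
  by (auto intro!: Ck_on_add open_chart_image A U)

lemma msmooth_mult:
  fixes f g :: "'m \<Rightarrow> 'b::real_normed_algebra"
  shows "msmooth A U f \<Longrightarrow> msmooth A U g \<Longrightarrow> msmooth A U (\<lambda>p. f p * g p)"
  unfolding msmooth_def smooth_on_def comp_def
  by (auto intro!: Ck_on_mult open_chart_image A U)

lemma msmooth_inverse:
  fixes f :: "'m \<Rightarrow> 'b::real_normed_field"
  assumes "msmooth A U f" "\<And>p. p \<in> U \<Longrightarrow> f p \<noteq> 0"
  shows "msmooth A U (\<lambda>p. inverse (f p))"
  unfolding msmooth_def smooth_on_def comp_def
proof (intro ballI allI)
  fix c k assume c: "c \<in> A"
  show "Ck_on k (\<lambda>x. inverse (f (chart_inv c x))) (snd c ` (U \<inter> fst c))"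
  proof (rule Ck_on_inverse[OF open_chart_image[OF A c U]])
    show "Ck_on k (\<lambda>x. f (chart_inv c x)) (snd c ` (U \<inter> fst c))"
      using assms(1) c by (simp add: msmooth_def smooth_on_def comp_def)
  qed (use assms(2) chart_inv_chart[OF A c] in auto)
qed

lemma mholo_const: "mholo A U (\<lambda>p. c)"
  unfolding mholo_def comp_def by (auto intro: holo_on_const open_chart_image A U)

lemma mholo_add: "mholo A U f \<Longrightarrow> mholo A U g \<Longrightarrow> mholo A U (\<lambda>p. f p + g p)"
  unfolding mholo_def comp_def by (auto intro!: holo_on_add open_chart_image A U)

lemma mholo_mult: "mholo A U f \<Longrightarrow> mholo A U g \<Longrightarrow> mholo A U (\<lambda>p. f p * g p)"
  unfolding mholo_def comp_def by (auto intro!: holo_on_mult open_chart_image A U)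

lemma mholo_sum:
  "(\<And>i. i \<in> I \<Longrightarrow> mholo A U (f i)) \<Longrightarrow> mholo A U (\<lambda>p. \<Sum>i\<in>I. f i p)"
  by (induction I rule: infinite_finite_induct) (auto intro: mholo_const mholo_add)

end

section \<open>Tangent vectors and differentials\<close>

context
  fixes A :: "('m::topological_space, 'n::finite) chart set"
  assumes A: "complex_atlas A"
begin

lemma transition_derivative:
  assumes c: "c \<in> A" "c' \<in> A" "p \<in> fst c" "p \<in> fst c'"
  defines "T \<equiv> frechet_derivative (snd c' \<circ> chart_inv c) (at (snd c p))"
  shows "((snd c' \<circ> chart_inv c) has_derivative T) (at (snd c p))"
    and "T (\<i> *s v) = \<i> *s T v"
proof -
  let ?S = "snd c ` (fst c' \<inter> fst c)"
  let ?F = "\<lambda>i x. snd c' (chart_inv c x) $ i"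
  have o: "open ?S" using A c by (intro open_chart_image[OF A]) (auto simp: complex_atlas_def)
  have x: "snd c p \<in> ?S" using c by auto
  have h: "holo_on (?F i) ?S" for i
  proof -
    have "holo_on (?F i) (snd c ` (fst c \<inter> fst c'))"
      using A c unfolding complex_atlas_def by blast
    then show ?thesis by (simp add: Int_commute)
  qed
  define L where "L v = (\<chi> i. frechet_derivative (?F i) (at (snd c p)) v)" for v
  have L: "((snd c' \<circ> chart_inv c) has_derivative L) (at (snd c p))"
  proof (subst has_derivative_componentwise_within, intro ballI)
    fix b :: "complex^'n" assume "b \<in> Basis"
    then obtain i u where b: "b = axis i u" unfolding Basis_vec_def by blast
    show "((\<lambda>x. (snd c' \<circ> chart_inv c) x \<bullet> b) has_derivative (\<lambda>v. L v \<bullet> b)) (at (snd c p))"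
      using has_derivative_inner_left[OF holo_on_has_derivative[OF o h x], of i u]
      by (simp add: b L_def inner_axis)
  qed
  then have T: "T = L" unfolding T_def by (rule frechet_derivative_at[symmetric])
  with L show "((snd c' \<circ> chart_inv c) has_derivative T) (at (snd c p))" by simp
  show "T (\<i> *s v) = \<i> *s T v"
    using h[unfolded holo_on_def, THEN conjunct2, THEN bspec, OF x] unfolding T L_def
    by (simp add: vec_eq_iff)
qed

text \<open>The chain rule for a change of charts. For \<open>f = snd c''\<close> it is the cocycle condition that makes
  coordinate vectors tangent vectors; for a function \<open>f\<close> it says that the differential may be computed
  in every chart.\<close>

lemma chart_chain_rule:
  assumes c: "c \<in> A" "c' \<in> A" "p \<in> fst c" "p \<in> fst c'"
    and f: "(f \<circ> chart_inv c') differentiable (at (snd c' p))"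
  shows "frechet_derivative (f \<circ> chart_inv c) (at (snd c p)) v =
    frechet_derivative (f \<circ> chart_inv c') (at (snd c' p))
      (frechet_derivative (snd c' \<circ> chart_inv c) (at (snd c p)) v)"
proof -
  let ?S = "snd c ` (fst c' \<inter> fst c)"
  let ?f = "frechet_derivative (f \<circ> chart_inv c') (at (snd c' p))"
  let ?T = "frechet_derivative (snd c' \<circ> chart_inv c) (at (snd c p))"
  have o: "open ?S" using A c by (intro open_chart_image[OF A]) (auto simp: complex_atlas_def)
  have "((f \<circ> chart_inv c') has_derivative ?f) (at ((snd c' \<circ> chart_inv c) (snd c p)))"
    using f c by (simp add: frechet_derivative_works chart_inv_chart[OF A])
  then have "((f \<circ> chart_inv c') \<circ> (snd c' \<circ> chart_inv c) has_derivative ?f \<circ> ?T) (at (snd c p))"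
    by (rule diff_chain_at[OF transition_derivative(1)[OF c]])
  then have "((f \<circ> chart_inv c) has_derivative ?f \<circ> ?T) (at (snd c p))"
    by (rule has_derivative_transform_within_open[OF _ o]) (use c in \<open>auto simp: chart_inv_chart[OF A]\<close>)
  from frechet_derivative_at[OF this, symmetric] show ?thesis by simp
qed

lemma coord_vec_in_tangent_space:
  assumes "c \<in> A" "p \<in> fst c"
  shows "coord_vec A c v p \<in> tangent_space A p"
  unfolding tangent_space_def
proof (intro CollectI conjI allI ballI impI)
  show "coord_vec A c v p c' = 0" if "\<not> (c' \<in> A \<and> p \<in> fst c')" for c'
    using that unfolding coord_vec_def by (rule if_not_P)
  fix c1 c2 assume c12: "c1 \<in> A" "c2 \<in> A" "p \<in> fst c1 \<inter> fst c2"
  then have p: "p \<in> fst c1" "p \<in> fst c2" by auto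
  show "coord_vec A c v p c2 =
      frechet_derivative (snd c2 \<circ> chart_inv c1) (at (snd c1 p)) (coord_vec A c v p c1)"
    using chart_chain_rule[OF assms(1) c12(1) assms(2) p(1)
        differentiableI[OF transition_derivative(1)[OF c12(1,2) p]], of v] c12(1,2) p
    by (simp add: coord_vec_def)
qed

lemma tscale_i_coord_vec:
  assumes "c \<in> A" "p \<in> fst c"
  shows "tscale \<i> (coord_vec A c v p) = coord_vec A c (\<i> *s v) p"
  using assms by (intro ext) (simp add: tscale_def coord_vec_def transition_derivative(2))

lemma tscale_i_in_tangent_space:
  assumes "X \<in> tangent_space A p"
  shows "tscale \<i> X \<in> tangent_space A p"
  unfolding tangent_space_def
proof (intro CollectI conjI allI ballI impI)
  show "tscale \<i> X c = 0" if "\<not> (c \<in> A \<and> p \<in> fst c)" for c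
  proof -
    have "X c = 0"
      using assms[unfolded tangent_space_def mem_Collect_eq, THEN conjunct1, THEN spec] that by (rule mp)
    then show ?thesis by (simp add: tscale_def)
  qed
  fix c c' assume c: "c \<in> A" "c' \<in> A" "p \<in> fst c \<inter> fst c'"
  have "X c' = frechet_derivative (snd c' \<circ> chart_inv c) (at (snd c p)) (X c)"
    using assms[unfolded tangent_space_def mem_Collect_eq, THEN conjunct2] c by blast
  moreover have "frechet_derivative (snd c' \<circ> chart_inv c) (at (snd c p)) (\<i> *s X c)
      = \<i> *s frechet_derivative (snd c' \<circ> chart_inv c) (at (snd c p)) (X c)"
    using transition_derivative(2) c by blast
  ultimately show "tscale \<i> X c' =
      frechet_derivative (snd c' \<circ> chart_inv c) (at (snd c p)) (tscale \<i> X c)"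
    by (simp only: tscale_def)
qed

lemma some_chart:
  assumes "c = (SOME c. c \<in> A \<and> p \<in> fst c)"
  shows "c \<in> A" "p \<in> fst c"
proof -
  have "\<exists>c. c \<in> A \<and> p \<in> fst c" using A unfolding complex_atlas_def by blast
  then have "c \<in> A \<and> p \<in> fst c" unfolding assms by (rule someI_ex)
  then show "c \<in> A" "p \<in> fst c" by simp_all
qed

lemma mdiff_coord_vec:
  assumes "msmooth A U f" "open U" "p \<in> U" "c \<in> A" "p \<in> fst c"
  shows "mdiff A f p (coord_vec A c v p) = frechet_derivative (f \<circ> chart_inv c) (at (snd c p)) v"
proof -
  define c0 where "c0 = (SOME c. c \<in> A \<and> p \<in> fst c)"
  note c0 = some_chart[OF c0_def]
  have "(f \<circ> chart_inv c0) differentiable (at (snd c0 p))"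
    using smooth_on_differentiable_on[of "f \<circ> chart_inv c0" "snd c0 ` (U \<inter> fst c0)"] assms(1,3) c0
      open_chart_image[OF A c0(1) assms(2)]
    by (simp add: msmooth_def differentiable_on_eq_differentiable_at)
  from chart_chain_rule[OF assms(4) c0(1) assms(5) c0(2) this] show ?thesis
    using c0 by (simp add: mdiff_def c0_def[symmetric] coord_vec_def Let_def)
qed

lemma mdbar_mholo:
  assumes "mholo A U f" "p \<in> U"
  shows "mdbar A f p X = 0"
proof -
  define c0 where "c0 = (SOME c. c \<in> A \<and> p \<in> fst c)"
  note c0 = some_chart[OF c0_def]
  have "snd c0 p \<in> snd c0 ` (U \<inter> fst c0)" using c0 assms by blast
  moreover have "holo_on (f \<circ> chart_inv c0) (snd c0 ` (U \<inter> fst c0))"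
    using assms(1) c0 by (simp add: mholo_def)
  ultimately have "frechet_derivative (f \<circ> chart_inv c0) (at (snd c0 p)) (\<i> *s X c0) =
      \<i> * frechet_derivative (f \<circ> chart_inv c0) (at (snd c0 p)) (X c0)"
    unfolding holo_on_def by blast
  then show ?thesis
    by (simp add: mdbar_def mdiff_def c0_def[symmetric] Let_def tscale_def)
qed

lemma mdiff_eq_0:
  assumes U: "open U" "p \<in> U" and f: "\<And>q. q \<in> U \<Longrightarrow> f q = 0"
  shows "mdiff A f p X = 0"
proof -
  define c0 where "c0 = (SOME c. c \<in> A \<and> p \<in> fst c)"
  note c0 = some_chart[OF c0_def]
  have p: "snd c0 p \<in> snd c0 ` (U \<inter> fst c0)" using c0 U by blast
  have "((f \<circ> chart_inv c0) has_derivative (\<lambda>_. 0)) (at (snd c0 p))"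
    by (rule has_derivative_transform_within_open[OF has_derivative_const[of 0]
          open_chart_image[OF A c0(1) U(1)] p])
       (use f chart_inv_chart[OF A c0(1)] in auto)
  from frechet_derivative_at[OF this, symmetric] show ?thesis
    by (simp add: mdiff_def c0_def[symmetric])
qed

text \<open>The differential is evaluated in a chosen chart, holomorphy is required in all of them; coordinate
  vectors mediate between the two.\<close>

lemma mholo_if_mdbar_zero:
  assumes f: "msmooth A U f" and U: "open U"
    and z: "\<And>p X. p \<in> U \<Longrightarrow> X \<in> tangent_space A p \<Longrightarrow> mdbar A f p X = 0"
  shows "mholo A U f"
  unfolding mholo_def holo_on_def
proof (intro ballI conjI allI)
  fix c assume c: "c \<in> A"
  show "smooth_on (f \<circ> chart_inv c) (snd c ` (U \<inter> fst c))" using f c unfolding msmooth_def by blast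
  fix x v assume "x \<in> snd c ` (U \<inter> fst c)"
  then obtain p where p: "p \<in> U" "p \<in> fst c" "x = snd c p" by blast
  have "mdbar A f p (coord_vec A c v p) = 0"
    using z p c coord_vec_in_tangent_space by blast
  then have "frechet_derivative (f \<circ> chart_inv c) (at x) v
      + \<i> * frechet_derivative (f \<circ> chart_inv c) (at x) (\<i> *s v) = 0" (is "?a + \<i> * ?b = 0")
    unfolding mdbar_def using p c by (simp add: tscale_i_coord_vec mdiff_coord_vec[OF f U])
  then have "\<i> * (?a + \<i> * ?b) = 0" by simp
  then show "?b = \<i> * ?a" by (simp add: algebra_simps)
qed

end

section \<open>Sections of holomorphic vector bundles\<close>

text \<open>A holomorphic vector bundle over a complex manifold, which need not be compact or Kaehler here.\<close>

locale holo_bundle =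
  fixes A :: "('m::topological_space, 'n::finite) chart set"
    and E :: "('m, 'v::ab_group_add) vbundle"
  assumes atlas: "complex_atlas A"
    and vec_bundle: "holo_vector_bundle A E"
begin

sublocale vector_space "scale E"
  using vec_bundle by (simp add: holo_vector_bundle_def)

lemma subspace_fibre: "subspace (fibre E p)"
  using vec_bundle by (simp add: holo_vector_bundle_def)

lemma trivs_local_triv: "\<tau> \<in> trivs E \<Longrightarrow> local_triv E \<tau>"
  using vec_bundle by (simp add: holo_vector_bundle_def)

lemma triv_cover: "\<exists>\<tau>. \<tau> \<in> trivs E \<and> p \<in> fst \<tau>"
proof -
  have "p \<in> (\<Union>\<tau>\<in>trivs E. fst \<tau>)" using vec_bundle by (simp add: holo_vector_bundle_def)
  then show ?thesis by blast
qed

lemma fibre_lincomb: "(\<And>i. i \<in> I \<Longrightarrow> v i \<in> fibre E p) \<Longrightarrow> (\<Sum>i\<in>I. scale E (c i) (v i)) \<in> fibre E p"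
  by (intro subspace_sum subspace_scale subspace_fibre)

lemma holo_section_subset:
  assumes "holo_section A E U \<xi>" "V \<subseteq> U"
  shows "holo_section A E V \<xi>"
  unfolding holo_section_def
proof (intro conjI ballI allI impI)
  show "\<xi> p \<in> fibre E p" if "p \<in> V" for p
    using assms that by (auto simp: holo_section_def)
  show "mholo A (V \<inter> fst \<tau>) (\<lambda>p. snd \<tau> p (\<xi> p) i)" if "\<tau> \<in> trivs E" "i < bundle_rank E" for \<tau> i
  proof (rule mholo_subset)
    show "mholo A (U \<inter> fst \<tau>) (\<lambda>p. snd \<tau> p (\<xi> p) i)"
      using assms(1) that by (simp add: holo_section_def)
  qed (use assms(2) in blast)
qed

lemma holo_section_smooth: "holo_section A E U \<xi> \<Longrightarrow> smooth_section A E U \<xi>"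
  by (simp add: holo_section_def smooth_section_def mholo_imp_msmooth)

lemma bundle_dbar_holo_section:
  assumes "holo_section A E U \<xi>" "p \<in> U"
  shows "bundle_dbar A E \<xi> p X = 0"
proof -
  define \<tau> where "\<tau> = (SOME \<tau>. \<tau> \<in> trivs E \<and> p \<in> fst \<tau>)"
  have \<tau>: "\<tau> \<in> trivs E \<and> p \<in> fst \<tau>"
    unfolding \<tau>_def by (rule someI_ex[OF triv_cover])
  have "mdbar A (\<lambda>q. snd \<tau> q (\<xi> q) i) p X = 0" if "i < bundle_rank E" for i
    using assms \<tau> that by (intro mdbar_mholo[OF atlas, of "U \<inter> fst \<tau>"]) (auto simp: holo_section_def)
  then show ?thesis by (simp add: bundle_dbar_def \<tau>_def[symmetric])
qed

context
  fixes \<tau> assumes \<tau>: "local_triv E \<tau>"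
begin

lemma open_local_triv: "open (fst \<tau>)"
  using \<tau> by (simp add: local_triv_def)

context
  fixes q assumes q: "q \<in> fst \<tau>"
begin

lemma triv_bij: "bij_betw (snd \<tau> q) (fibre E q) (coord_space (bundle_rank E))"
  using \<tau> q by (simp add: local_triv_def)

lemma triv_add: "v \<in> fibre E q \<Longrightarrow> w \<in> fibre E q \<Longrightarrow> snd \<tau> q (v + w) i = snd \<tau> q v i + snd \<tau> q w i"
  using \<tau> q by (simp add: local_triv_def)

lemma triv_scale: "v \<in> fibre E q \<Longrightarrow> snd \<tau> q (scale E a v) i = a * snd \<tau> q v i"
  using \<tau> q by (simp add: local_triv_def)

lemma triv_zero: "snd \<tau> q 0 i = 0"
  using triv_scale[of 0 0] subspace_0[OF subspace_fibre] by simp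

lemma triv_diff: "v \<in> fibre E q \<Longrightarrow> w \<in> fibre E q \<Longrightarrow> snd \<tau> q (v - w) i = snd \<tau> q v i - snd \<tau> q w i"
  using triv_add[of "v - w" w i] subspace_diff[OF subspace_fibre] by simp

lemma triv_lincomb:
  "(\<And>j. j \<in> I \<Longrightarrow> v j \<in> fibre E q) \<Longrightarrow>
    snd \<tau> q (\<Sum>j\<in>I. scale E (c j) (v j)) i = (\<Sum>j\<in>I. c j * snd \<tau> q (v j) i)"
proof (induction I rule: infinite_finite_induct)
  case (insert x F)
  then show ?case
    by (simp add: triv_add triv_scale fibre_lincomb subspace_scale[OF subspace_fibre])
qed (simp_all add: triv_zero)

lemma triv_eqI:
  "v \<in> fibre E q \<Longrightarrow> w \<in> fibre E q \<Longrightarrow> (\<And>i. snd \<tau> q v i = snd \<tau> q w i) \<Longrightarrow> v = w"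
  using inj_onD[OF bij_betw_imp_inj_on[OF triv_bij], of v w] by blast

lemma triv_vanish: "v \<in> fibre E q \<Longrightarrow> i \<ge> bundle_rank E \<Longrightarrow> snd \<tau> q v i = 0"
  using bij_betwE[OF triv_bij] by (auto simp: coord_space_def)

lemma
  assumes "j < bundle_rank E"
  shows triv_frame_in_fibre: "triv_frame E \<tau> j q \<in> fibre E q"
    and triv_coord_frame: "snd \<tau> q (triv_frame E \<tau> j q) = (\<lambda>i. if i = j then 1 else 0)"
proof -
  have "(\<lambda>i. if i = j then 1 else 0) \<in> snd \<tau> q ` fibre E q"
    using triv_bij assms by (auto simp: bij_betw_def coord_space_def)
  then show "triv_frame E \<tau> j q \<in> fibre E q"
    "snd \<tau> q (triv_frame E \<tau> j q) = (\<lambda>i. if i = j then 1 else 0)"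
    unfolding triv_frame_def by (rule inv_into_into, rule f_inv_into_f)
qed

lemma triv_coord_lincomb_frame:
  assumes "I \<subseteq> {..<bundle_rank E}"
  shows "snd \<tau> q (\<Sum>j\<in>I. scale E (c j) (triv_frame E \<tau> j q)) i = (if i \<in> I then c i else 0)"
proof -
  have "snd \<tau> q (\<Sum>j\<in>I. scale E (c j) (triv_frame E \<tau> j q)) i
      = (\<Sum>j\<in>I. c j * snd \<tau> q (triv_frame E \<tau> j q) i)"
    using assms by (intro triv_lincomb triv_frame_in_fibre) auto
  also have "\<dots> = (\<Sum>j\<in>I. if i = j then c j else 0)"
    using assms by (intro sum.cong refl) (auto simp: triv_coord_frame subset_iff)
  finally show ?thesis using finite_subset[OF assms] by simp
qed

lemma triv_frame_independent:
  assumes "I \<subseteq> {..<bundle_rank E}" "(\<Sum>j\<in>I. scale E (c j) (triv_frame E \<tau> j q)) = 0" "i \<in> I"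
  shows "c i = 0"
  using triv_coord_lincomb_frame[OF assms(1), of c i] assms(2,3) by (simp add: triv_zero)

lemma triv_frame_expansion:
  assumes v: "v \<in> fibre E q" and k: "k \<le> bundle_rank E" "\<And>i. i \<ge> k \<Longrightarrow> snd \<tau> q v i = 0"
  shows "v = (\<Sum>j<k. scale E (snd \<tau> q v j) (triv_frame E \<tau> j q))"
proof (rule triv_eqI[OF v])
  show "(\<Sum>j<k. scale E (snd \<tau> q v j) (triv_frame E \<tau> j q)) \<in> fibre E q"
    using k by (intro fibre_lincomb triv_frame_in_fibre) auto
  show "snd \<tau> q v i = snd \<tau> q (\<Sum>j<k. scale E (snd \<tau> q v j) (triv_frame E \<tau> j q)) i" for i
    using k by (subst triv_coord_lincomb_frame) auto
qed

end

end

text \<open>The transition matrix acts on the components of a vector.\<close>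

lemma triv_change:
  assumes \<tau>: "local_triv E \<tau>" "local_triv E \<tau>'" and q: "q \<in> fst \<tau>" "q \<in> fst \<tau>'" and v: "v \<in> fibre E q"
  shows "snd \<tau>' q v i = (\<Sum>j<bundle_rank E. snd \<tau> q v j * snd \<tau>' q (triv_frame E \<tau> j q) i)"
proof -
  have "v = (\<Sum>j<bundle_rank E. scale E (snd \<tau> q v j) (triv_frame E \<tau> j q))"
    using triv_vanish[OF \<tau>(1) q(1) v] by (intro triv_frame_expansion[OF \<tau>(1) q(1) v]) auto
  then have "snd \<tau>' q v i = snd \<tau>' q (\<Sum>j<bundle_rank E. scale E (snd \<tau> q v j) (triv_frame E \<tau> j q)) i"
    by simp
  also have "\<dots> = (\<Sum>j<bundle_rank E. snd \<tau> q v j * snd \<tau>' q (triv_frame E \<tau> j q) i)"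
    by (intro triv_lincomb[OF \<tau>(2) q(2)] triv_frame_in_fibre[OF \<tau>(1) q(1)]) simp
  finally show ?thesis .
qed

lemma holo_section_triv_frame:
  assumes "holo_triv A E \<tau>" "j < bundle_rank E"
  shows "holo_section A E (fst \<tau>) (triv_frame E \<tau> j)"
  using assms triv_frame_in_fibre by (simp add: holo_section_def holo_triv_def holo_transition_def)

lemma smooth_section_zero: "open U \<Longrightarrow> smooth_section A E U (\<lambda>q. 0)"
proof -
  assume U: "open U"
  have "msmooth A (U \<inter> fst \<tau>) (\<lambda>p. snd \<tau> p 0 i)" if t: "\<tau> \<in> trivs E" for \<tau> i
  proof -
    have o: "open (U \<inter> fst \<tau>)" using U open_local_triv[OF trivs_local_triv[OF t]] by blast
    show ?thesis
      by (rule msmooth_cong[OF atlas o msmooth_const[OF atlas o, of 0]])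
         (simp add: triv_zero[OF trivs_local_triv[OF t]])
  qed
  then show ?thesis by (simp add: smooth_section_def subspace_0[OF subspace_fibre])
qed

lemma smooth_section_add:
  assumes U: "open U" and s: "smooth_section A E U \<xi>" "smooth_section A E U \<eta>"
  shows "smooth_section A E U (\<lambda>q. \<xi> q + \<eta> q)"
proof -
  have f: "\<xi> q \<in> fibre E q" "\<eta> q \<in> fibre E q" if "q \<in> U" for q
    using s that by (simp_all add: smooth_section_def)
  have "msmooth A (U \<inter> fst \<tau>) (\<lambda>p. snd \<tau> p (\<xi> p + \<eta> p) i)"
    if t: "\<tau> \<in> trivs E" and i: "i < bundle_rank E" for \<tau> i
  proof -
    have o: "open (U \<inter> fst \<tau>)" using U open_local_triv[OF trivs_local_triv[OF t]] by blast
    have "msmooth A (U \<inter> fst \<tau>) (\<lambda>p. snd \<tau> p (\<xi> p) i + snd \<tau> p (\<eta> p) i)"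
      using s t i by (intro msmooth_add[OF atlas o]) (simp_all add: smooth_section_def)
    then show ?thesis
      by (rule msmooth_cong[OF atlas o]) (simp add: triv_add[OF trivs_local_triv[OF t]] f)
  qed
  then show ?thesis using f by (simp add: smooth_section_def subspace_add[OF subspace_fibre])
qed

lemma smooth_section_scale:
  assumes U: "open U" and s: "msmooth A U f" "smooth_section A E U \<xi>"
  shows "smooth_section A E U (\<lambda>q. scale E (f q) (\<xi> q))"
proof -
  have f: "\<xi> q \<in> fibre E q" if "q \<in> U" for q
    using s that by (simp add: smooth_section_def)
  have "msmooth A (U \<inter> fst \<tau>) (\<lambda>p. snd \<tau> p (scale E (f p) (\<xi> p)) i)"
    if t: "\<tau> \<in> trivs E" and i: "i < bundle_rank E" for \<tau> i
  proof -
    have o: "open (U \<inter> fst \<tau>)" using U open_local_triv[OF trivs_local_triv[OF t]] by blast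
    have "msmooth A (U \<inter> fst \<tau>) (\<lambda>p. f p * snd \<tau> p (\<xi> p) i)"
      using s t i by (intro msmooth_mult[OF atlas o] msmooth_subset[OF s(1)]) (simp_all add: smooth_section_def)
    then show ?thesis
      by (rule msmooth_cong[OF atlas o]) (simp add: triv_scale[OF trivs_local_triv[OF t]] f)
  qed
  then show ?thesis using f by (simp add: smooth_section_def subspace_scale[OF subspace_fibre])
qed

lemma smooth_section_lincomb:
  assumes U: "open U" and "\<And>i. i \<in> I \<Longrightarrow> msmooth A U (f i)" "\<And>i. i \<in> I \<Longrightarrow> smooth_section A E U (\<xi> i)"
  shows "smooth_section A E U (\<lambda>q. \<Sum>i\<in>I. scale E (f i q) (\<xi> i q))"
  using assms(2,3)
proof (induction I rule: infinite_finite_induct)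
  case (insert x F)
  then show ?case by (simp add: smooth_section_add[OF U] smooth_section_scale[OF U])
qed (simp_all add: smooth_section_zero[OF U])

lemma smooth_section_diff_lincomb:
  assumes U: "open U" and \<eta>: "smooth_section A E U \<eta>"
    and "\<And>i. i \<in> I \<Longrightarrow> msmooth A U (f i)" "\<And>i. i \<in> I \<Longrightarrow> smooth_section A E U (\<xi> i)"
  shows "smooth_section A E U (\<lambda>q. \<eta> q - (\<Sum>i\<in>I. scale E (f i q) (\<xi> i q)))"
proof -
  have "smooth_section A E U (\<lambda>q. \<eta> q + scale E (- 1) (\<Sum>i\<in>I. scale E (f i q) (\<xi> i q)))"
    by (intro smooth_section_add smooth_section_scale smooth_section_lincomb msmooth_const atlas assms)
  then show ?thesis by simp
qed

text \<open>A trivialisation adapted to a subspace \<open>S q\<close> of a fibre: the first \<open>k\<close> frame vectors span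
  \<open>S q\<close>.\<close>

context
  fixes S :: "'m \<Rightarrow> 'v set" and \<tau> k q
  assumes sub: "S q \<subseteq> fibre E q" and lt: "local_triv E \<tau>" and q: "q \<in> fst \<tau>"
    and adapted: "snd \<tau> q ` S q = coord_space k" and k: "k \<le> bundle_rank E"
begin

lemma mem_adapted_iff: "v \<in> S q \<longleftrightarrow> v \<in> fibre E q \<and> (\<forall>i\<ge>k. snd \<tau> q v i = 0)"
proof
  assume "v \<in> S q"
  then show "v \<in> fibre E q \<and> (\<forall>i\<ge>k. snd \<tau> q v i = 0)"
    using adapted sub unfolding coord_space_def by blast
next
  assume v: "v \<in> fibre E q \<and> (\<forall>i\<ge>k. snd \<tau> q v i = 0)"
  then have "snd \<tau> q v \<in> snd \<tau> q ` S q" unfolding adapted coord_space_def by blast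
  then obtain s where s: "s \<in> S q" "snd \<tau> q v = snd \<tau> q s" by blast
  then have "v = s" using v sub by (intro triv_eqI[OF lt q]) auto
  then show "v \<in> S q" using s by simp
qed

lemma triv_frame_in_adapted: "i < k \<Longrightarrow> triv_frame E \<tau> i q \<in> S q"
  using k by (simp add: mem_adapted_iff triv_frame_in_fibre[OF lt q] triv_coord_frame[OF lt q])

lemma adapted_expansion:
  "s \<in> S q \<Longrightarrow> s = (\<Sum>i<k. scale E (snd \<tau> q s i) (triv_frame E \<tau> i q))"
  using triv_frame_expansion[OF lt q _ k] mem_adapted_iff by blast

end

end

section \<open>Hermitian metrics and orthogonalisation\<close>

text \<open>A holomorphic vector bundle with a hermitian metric \<open>h\<close>.\<close>

locale hermitian_bundle = holo_bundle A E
  for A :: "('m::topological_space, 'n::finite) chart set" and E :: "('m, 'v::ab_group_add) vbundle" +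
  fixes h :: "'m \<Rightarrow> 'v \<Rightarrow> 'v \<Rightarrow> complex"
  assumes metric: "hermitian_metric A E h"
begin

lemma msmooth_metric:
  "open U \<Longrightarrow> smooth_section A E U \<xi> \<Longrightarrow> smooth_section A E U \<eta> \<Longrightarrow> msmooth A U (\<lambda>p. h p (\<xi> p) (\<eta> p))"
  using metric by (simp add: hermitian_metric_def)

context
  fixes p :: 'm
begin

lemma metric_add_left:
  "v \<in> fibre E p \<Longrightarrow> w \<in> fibre E p \<Longrightarrow> u \<in> fibre E p \<Longrightarrow> h p (v + w) u = h p v u + h p w u"
  by (rule metric[unfolded hermitian_metric_def, THEN conjunct1, THEN spec[of _ p], THEN bspec,
        THEN bspec, THEN conjunct1, THEN bspec])

lemma metric_scale_left:
  "v \<in> fibre E p \<Longrightarrow> w \<in> fibre E p \<Longrightarrow> h p (scale E a v) w = a * h p v w"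
  by (rule metric[unfolded hermitian_metric_def, THEN conjunct1, THEN spec[of _ p], THEN bspec,
        THEN bspec, THEN conjunct2, THEN conjunct1, THEN spec])

lemma metric_cnj: "v \<in> fibre E p \<Longrightarrow> w \<in> fibre E p \<Longrightarrow> h p w v = cnj (h p v w)"
  by (rule metric[unfolded hermitian_metric_def, THEN conjunct1, THEN spec[of _ p], THEN bspec,
        THEN bspec, THEN conjunct2, THEN conjunct2, THEN conjunct1])

lemma metric_scale_right:
  assumes "v \<in> fibre E p" "w \<in> fibre E p"
  shows "h p v (scale E a w) = cnj a * h p v w"
proof -
  have "scale E a w \<in> fibre E p" using assms(2) by (rule subspace_scale[OF subspace_fibre])
  then show ?thesis
    using assms metric_cnj[of "scale E a w" v] metric_cnj[of w v] by (simp add: metric_scale_left)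
qed

lemma metric_self_eq_0: "v \<in> fibre E p \<Longrightarrow> h p v v = 0 \<Longrightarrow> v = 0"
  using metric[unfolded hermitian_metric_def, THEN conjunct1, THEN spec[of _ p], THEN bspec,
    THEN bspec, THEN conjunct2, THEN conjunct2, THEN conjunct2, of v v] by fastforce

lemma metric_zero_left: "w \<in> fibre E p \<Longrightarrow> h p 0 w = 0"
  using metric_scale_left[of 0 w 0] subspace_0[OF subspace_fibre] by simp

lemma metric_diff_left:
  "v \<in> fibre E p \<Longrightarrow> w \<in> fibre E p \<Longrightarrow> u \<in> fibre E p \<Longrightarrow> h p (v - w) u = h p v u - h p w u"
  using metric_add_left[of "v - w" w u] subspace_diff[OF subspace_fibre] by simp

lemma metric_lincomb_left:
  "(\<And>i. i \<in> I \<Longrightarrow> v i \<in> fibre E p) \<Longrightarrow> w \<in> fibre E p \<Longrightarrow>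
    h p (\<Sum>i\<in>I. scale E (c i) (v i)) w = (\<Sum>i\<in>I. c i * h p (v i) w)"
proof (induction I rule: infinite_finite_induct)
  case (insert x F)
  then show ?case
    by (simp add: metric_add_left metric_scale_left fibre_lincomb subspace_scale[OF subspace_fibre])
qed (simp_all add: metric_zero_left)

lemma metric_eq_0_commute: "v \<in> fibre E p \<Longrightarrow> w \<in> fibre E p \<Longrightarrow> h p v w = 0 \<Longrightarrow> h p w v = 0"
  using metric_cnj[of v w] by simp

lemma metric_lincomb_right_eq_0:
  assumes "\<And>i. i \<in> I \<Longrightarrow> v i \<in> fibre E p" "w \<in> fibre E p" "\<And>i. i \<in> I \<Longrightarrow> h p w (v i) = 0"
  shows "h p w (\<Sum>i\<in>I. scale E (c i) (v i)) = 0"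
proof -
  have "h p (\<Sum>i\<in>I. scale E (c i) (v i)) w = 0"
    using metric_eq_0_commute[OF assms(2,1,3)] by (simp add: metric_lincomb_left assms(1,2))
  moreover have "(\<Sum>i\<in>I. scale E (c i) (v i)) \<in> fibre E p"
    by (rule fibre_lincomb) (rule assms(1))
  ultimately show ?thesis using metric_eq_0_commute assms(2) by blast
qed

end

text \<open>The orthogonal projection to the span of pointwise independent smooth sections has smooth
  coefficients. The induction orthogonalises one section at a time, so that no Gram determinant has to
  be inverted; only the coefficients with respect to the given sections are recorded.\<close>

lemma gram_schmidt:
  fixes m :: nat
  assumes U: "open U" and e: "\<And>i. i < m \<Longrightarrow> smooth_section A E U (e i)"
    and indep: "\<And>q c i. q \<in> U \<Longrightarrow> (\<Sum>i<m. scale E (c i) (e i q)) = 0 \<Longrightarrow> i < m \<Longrightarrow> c i = 0"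
    and \<eta>: "smooth_section A E U \<eta>"
  shows "\<exists>a. (\<forall>i<m. msmooth A U (a i)) \<and>
    (\<forall>q\<in>U. \<forall>l<m. h q (\<eta> q - (\<Sum>i<m. scale E (a i q) (e i q))) (e l q) = 0)"
  using e indep \<eta>
proof (induction m arbitrary: \<eta>)
  case (Suc m)
  have IH: "\<exists>a. (\<forall>i<m. msmooth A U (a i)) \<and>
    (\<forall>q\<in>U. \<forall>l<m. h q (\<xi> q - (\<Sum>i<m. scale E (a i q) (e i q))) (e l q) = 0)"
    if \<xi>: "smooth_section A E U \<xi>" for \<xi>
  proof (rule Suc.IH)
    show "smooth_section A E U (e i)" if "i < m" for i using Suc.prems(1) that by simp
    show "c i = 0" if "q \<in> U" "(\<Sum>i<m. scale E (c i) (e i q)) = 0" "i < m" for q c i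
      using Suc.prems(2)[of q "\<lambda>i. if i < m then c i else 0" i] that by simp
  qed (rule \<xi>)
  have em: "smooth_section A E U (e m)" using Suc.prems(1) by simp
  obtain a where a: "\<And>i. i < m \<Longrightarrow> msmooth A U (a i)"
      "\<And>q l. q \<in> U \<Longrightarrow> l < m \<Longrightarrow> h q (\<eta> q - (\<Sum>i<m. scale E (a i q) (e i q))) (e l q) = 0"
    using IH[OF Suc.prems(3)] by blast
  obtain b where b: "\<And>i. i < m \<Longrightarrow> msmooth A U (b i)"
      "\<And>q l. q \<in> U \<Longrightarrow> l < m \<Longrightarrow> h q (e m q - (\<Sum>i<m. scale E (b i q) (e i q))) (e l q) = 0"
    using IH[OF em] by blast
  define \<eta>' where "\<eta>' q = \<eta> q - (\<Sum>i<m. scale E (a i q) (e i q))" for q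
  define w where "w q = e m q - (\<Sum>i<m. scale E (b i q) (e i q))" for q
  \<comment> \<open>\<open>w\<close> is the part of the new section orthogonal to the previous ones; \<open>t w\<close> is the projection of
    \<open>\<eta>'\<close> to it.\<close>
  define t where "t q = h q (\<eta>' q) (w q) * inverse (h q (w q) (w q))" for q
  define a' where "a' i = (if i = m then t else (\<lambda>q. a i q + (- 1) * (t q * b i q)))" for i
  have s\<eta>': "smooth_section A E U \<eta>'" unfolding \<eta>'_def
    using Suc.prems(1,3) a(1) by (intro smooth_section_diff_lincomb U) auto
  have sw: "smooth_section A E U w" unfolding w_def
    using Suc.prems(1) b(1) by (intro smooth_section_diff_lincomb U) auto
  have fib: "e i q \<in> fibre E q" if "i \<le> m" "q \<in> U" for i q
    using Suc.prems(1)[of i] that by (simp add: smooth_section_def)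
  have fib': "\<eta>' q \<in> fibre E q" "w q \<in> fibre E q" if "q \<in> U" for q
    using s\<eta>' sw that by (simp_all add: smooth_section_def)
  have ww: "h q (w q) (w q) \<noteq> 0" if q: "q \<in> U" for q
  proof
    assume "h q (w q) (w q) = 0"
    then have "w q = 0" using metric_self_eq_0 fib' q by blast
    then have "(\<Sum>i<Suc m. scale E (if i = m then 1 else - b i q) (e i q)) = 0"
      by (simp add: w_def sum_negf)
    from Suc.prems(2)[OF q this, of m] show False by simp
  qed
  have st: "msmooth A U t" unfolding t_def
    by (intro msmooth_mult msmooth_inverse msmooth_metric atlas U s\<eta>' sw ww)
  have smooth_a': "msmooth A U (a' i)" if "i < Suc m" for i
  proof (cases "i = m")
    case False
    with that have "i < m" by simp
    then have "msmooth A U (\<lambda>q. a i q + (- 1) * (t q * b i q))"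
      by (intro msmooth_add msmooth_mult msmooth_const atlas U a(1) b(1) st)
    then show ?thesis using False unfolding a'_def by simp
  qed (simp add: a'_def st)
  have split: "\<eta> q - (\<Sum>i<Suc m. scale E (a' i q) (e i q)) = \<eta>' q - scale E (t q) (w q)" for q
  proof -
    have "(\<Sum>i<m. scale E (a' i q) (e i q)) =
        (\<Sum>i<m. scale E (a i q) (e i q)) - scale E (t q) (\<Sum>i<m. scale E (b i q) (e i q))"
      unfolding scale_sum_right sum_subtractf[symmetric]
      by (intro sum.cong refl) (simp add: a'_def scale_left_diff_distrib)
    then show ?thesis
      by (simp add: \<eta>'_def w_def a'_def scale_right_diff_distrib)
  qed
  have "h q (\<eta>' q - scale E (t q) (w q)) (e l q) = 0" if q: "q \<in> U" and l: "l < Suc m" for q l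
  proof -
    let ?z = "\<eta>' q - scale E (t q) (w q)"
    have zf: "?z \<in> fibre E q" using fib' q by (intro subspace_diff subspace_scale subspace_fibre)
    have exp: "h q ?z u = h q (\<eta>' q) u - t q * h q (w q) u" if "u \<in> fibre E q" for u
      using fib' q that by (simp add: metric_diff_left metric_scale_left subspace_scale[OF subspace_fibre])
    have low: "h q ?z (e i q) = 0" if "i < m" for i
      using a(2)[OF q that] b(2)[OF q that] fib[of i q] that q
      by (simp add: exp \<eta>'_def[symmetric] w_def[symmetric])
    have "h q ?z (e m q) = 0"
    proof -
      have "h q (e m q) ?z = h q (w q + (\<Sum>i<m. scale E (b i q) (e i q))) ?z" by (simp add: w_def)
      also have "\<dots> = h q (w q) ?z + h q (\<Sum>i<m. scale E (b i q) (e i q)) ?z"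
        using fib fib' q zf by (intro metric_add_left fibre_lincomb) auto
      also have "h q (w q) ?z = 0"
      proof (rule metric_eq_0_commute[OF zf])
        show "w q \<in> fibre E q" using fib' q by simp
        have "h q ?z (w q) = h q (\<eta>' q) (w q) - t q * h q (w q) (w q)"
          by (rule exp) fact
        then show "h q ?z (w q) = 0" using ww[OF q] by (simp add: t_def)
      qed
      also have "h q (\<Sum>i<m. scale E (b i q) (e i q)) ?z = 0"
      proof (rule metric_eq_0_commute[OF zf])
        show "(\<Sum>i<m. scale E (b i q) (e i q)) \<in> fibre E q"
          using fib q by (intro fibre_lincomb) auto
        show "h q ?z (\<Sum>i<m. scale E (b i q) (e i q)) = 0"
          using low fib q by (intro metric_lincomb_right_eq_0 zf) auto
      qed
      finally have "h q (e m q) ?z = 0" by simp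
      then show ?thesis using metric_eq_0_commute[OF _ zf] fib q by simp
    qed
    with low l show ?thesis by (auto simp: less_Suc_eq)
  qed
  with smooth_a' show ?case unfolding split[symmetric] by blast
qed simp

lemma orth_complI:
  assumes sub: "S q \<subseteq> fibre E q" and lt: "local_triv E \<tau>" and q: "q \<in> fst \<tau>"
    and adapted: "snd \<tau> q ` S q = coord_space k" and k: "k \<le> bundle_rank E"
    and v: "v \<in> fibre E q" and o: "\<And>i. i < k \<Longrightarrow> h q v (triv_frame E \<tau> i q) = 0"
  shows "v \<in> orth_compl E h S q"
proof -
  have "h q v s = 0" if s: "s \<in> S q" for s
  proof -
    have "h q v (\<Sum>i<k. scale E (snd \<tau> q s i) (triv_frame E \<tau> i q)) = 0"
      using k o by (intro metric_lincomb_right_eq_0 v triv_frame_in_fibre[OF lt q]) auto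
    then show ?thesis
      using adapted_expansion[where S = S and q = q and \<tau> = \<tau> and k = k, OF sub lt q adapted k s] by simp
  qed
  then show ?thesis using v by (simp add: orth_compl_def)
qed

lemma subspace_orth_compl:
  assumes "S p \<subseteq> fibre E p"
  shows "subspace (orth_compl E h S p)"
proof (rule subspaceI)
  show "0 \<in> orth_compl E h S p"
    using assms by (auto simp: orth_compl_def metric_zero_left subspace_0[OF subspace_fibre])
  show "x + y \<in> orth_compl E h S p" if "x \<in> orth_compl E h S p" "y \<in> orth_compl E h S p" for x y
    using assms that by (auto simp: orth_compl_def metric_add_left subspace_add[OF subspace_fibre] subset_iff)
  show "scale E c x \<in> orth_compl E h S p" if "x \<in> orth_compl E h S p" for x c
    using assms that by (auto simp: orth_compl_def metric_scale_left subspace_scale[OF subspace_fibre] subset_iff)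
qed

lemma orth_compl_disjoint:
  assumes "v \<in> S p" "v \<in> orth_compl E h S p"
  shows "v = 0"
  using assms metric_self_eq_0 by (auto simp: orth_compl_def)

end

section \<open>Trivialisations adapted to the orthogonal complement\<close>

text \<open>Suppose that \<open>e\<^sub>0, \<dots>, e\<^sub>r\<^sub>-\<^sub>1\<close> is a frame and \<open>f\<^sub>j = e\<^sub>j - (\<Sum>i<k. b i j e\<^sub>i)\<close> for \<open>k \<le> j < r\<close>.
  \<open>shear k r b\<close> sends the components of a vector in the frame \<open>e\<close> to those in the frame
  \<open>f\<^sub>k, \<dots>, f\<^sub>r\<^sub>-\<^sub>1, e\<^sub>0, \<dots>, e\<^sub>k\<^sub>-\<^sub>1\<close>. The \<open>f\<^sub>j\<close> come first because an adapted trivialisation maps the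
  subbundle to an initial coordinate space.\<close>

definition shear :: "nat \<Rightarrow> nat \<Rightarrow> (nat \<Rightarrow> nat \<Rightarrow> complex) \<Rightarrow> (nat \<Rightarrow> complex) \<Rightarrow> nat \<Rightarrow> complex" where
  "shear k r b x m =
     (if m < r - k then x (k + m)
      else if m < r then x (m - (r - k)) + (\<Sum>j=k..<r. b (m - (r - k)) j * x j) else 0)"

text \<open>The inverse of \<open>shear k r b\<close> on \<open>coord_space r\<close>; being polynomial in \<open>b\<close>, it makes the new
  transition matrices holomorphic in both directions.\<close>

definition unshear :: "nat \<Rightarrow> nat \<Rightarrow> (nat \<Rightarrow> nat \<Rightarrow> complex) \<Rightarrow> (nat \<Rightarrow> complex) \<Rightarrow> nat \<Rightarrow> complex" where
  "unshear k r b y n =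
     (if n < k then y (r - k + n) - (\<Sum>j=k..<r. b n j * y (j - k))
      else if n < r then y (n - k) else 0)"

lemma unshear_shear:
  assumes "k \<le> r" "x \<in> coord_space r"
  shows "unshear k r b (shear k r b x) = x"
proof
  fix n
  have "(\<Sum>j=k..<r. b n j * shear k r b x (j - k)) = (\<Sum>j=k..<r. b n j * x j)"
    by (intro sum.cong refl) (auto simp: shear_def)
  then show "unshear k r b (shear k r b x) n = x n"
    using assms by (auto simp: unshear_def shear_def coord_space_def)
qed

lemma shear_unshear:
  assumes "k \<le> r" "y \<in> coord_space r"
  shows "shear k r b (unshear k r b y) = y"
proof
  fix m
  have "(\<Sum>j=k..<r. b n j * unshear k r b y j) = (\<Sum>j=k..<r. b n j * y (j - k))" for n
    by (intro sum.cong refl) (auto simp: unshear_def)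
  then show "shear k r b (unshear k r b y) m = y m"
    using assms by (auto simp: unshear_def shear_def coord_space_def)
qed

lemma bij_betw_shear:
  assumes "k \<le> r"
  shows "bij_betw (shear k r b) (coord_space r) (coord_space r)"
  by (rule bij_betw_byWitness[where f' = "unshear k r b"])
     (use assms in \<open>auto simp: unshear_shear shear_unshear, auto simp: coord_space_def shear_def unshear_def\<close>)

text \<open>The trivialisation \<open>\<tau>\<close> after this change of frame, with \<open>b\<close> replaced by functions \<open>a i j\<close> on the
  domain of \<open>\<tau>\<close>.\<close>

definition shear_triv ::
  "('m, 'v) vbundle \<Rightarrow> 'm set \<times> ('m \<Rightarrow> 'v \<Rightarrow> nat \<Rightarrow> complex) \<Rightarrow> nat \<Rightarrow> (nat \<Rightarrow> nat \<Rightarrow> 'm \<Rightarrow> complex) \<Rightarrow>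
   'm set \<times> ('m \<Rightarrow> 'v \<Rightarrow> nat \<Rightarrow> complex)" where
  "shear_triv E \<tau> k a =
     (fst \<tau>, \<lambda>q v. shear k (bundle_rank E) (\<lambda>i j. a i j q) (snd \<tau> q v))"

context holo_bundle
begin

lemma local_triv_shear:
  assumes \<tau>: "local_triv E \<tau>" and k: "k \<le> bundle_rank E"
  shows "local_triv E (shear_triv E \<tau> k a)"
proof -
  let ?r = "bundle_rank E"
  let ?s = "\<lambda>q v. shear k ?r (\<lambda>i j. a i j q) (snd \<tau> q v)"
  have bij: "bij_betw (?s q) (fibre E q) (coord_space ?r)" if q: "q \<in> fst \<tau>" for q
    using bij_betw_trans[OF triv_bij[OF \<tau> q] bij_betw_shear[OF k]] by (simp add: comp_def)
  have add: "?s q (v + w) i = ?s q v i + ?s q w i"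
    if "q \<in> fst \<tau>" "v \<in> fibre E q" "w \<in> fibre E q" for q v w i
    using that by (simp add: shear_def triv_add[OF \<tau>] distrib_left sum.distrib)
  have sc: "?s q (scale E c v) i = c * ?s q v i" if "q \<in> fst \<tau>" "v \<in> fibre E q" for q v c i
    using that by (simp add: shear_def triv_scale[OF \<tau>] distrib_left sum_distrib_left mult.left_commute)
  show ?thesis
    using bij add sc open_local_triv[OF \<tau>] by (simp add: local_triv_def shear_triv_def)
qed

lemma triv_coord_shear_frame:
  assumes \<tau>: "local_triv E \<tau>" and k: "k \<le> bundle_rank E" and q: "q \<in> fst \<tau>" and m: "m < bundle_rank E"
  shows "snd \<tau> q (triv_frame E (shear_triv E \<tau> k a) m q) =
    unshear k (bundle_rank E) (\<lambda>i j. a i j q) (\<lambda>i. if i = m then 1 else 0)"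
proof -
  let ?v = "triv_frame E (shear_triv E \<tau> k a) m q"
  let ?b = "\<lambda>i j. a i j q"
  have q': "q \<in> fst (shear_triv E \<tau> k a)" using q by (simp add: shear_triv_def)
  have v: "?v \<in> fibre E q"
    by (rule triv_frame_in_fibre[OF local_triv_shear[OF \<tau> k] q' m])
  have "shear k (bundle_rank E) ?b (snd \<tau> q ?v) = (\<lambda>i. if i = m then 1 else 0)"
    using triv_coord_frame[OF local_triv_shear[OF \<tau> k] q' m] by (simp add: shear_triv_def)
  moreover have "snd \<tau> q ?v \<in> coord_space (bundle_rank E)"
    using bij_betwE[OF triv_bij[OF \<tau> q]] v by blast
  ultimately show ?thesis using unshear_shear[OF k] by metis
qed

lemma holo_triv_shear:
  assumes \<tau>: "holo_triv A E \<tau>" and k: "k \<le> bundle_rank E"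
    and a: "\<And>i j. i < k \<Longrightarrow> j \<in> {k..<bundle_rank E} \<Longrightarrow> mholo A (fst \<tau>) (a i j)"
  shows "holo_triv A E (shear_triv E \<tau> k a)"
proof -
  let ?r = "bundle_rank E"
  let ?\<sigma> = "shear_triv E \<tau> k a"
  have lt: "local_triv E \<tau>" using \<tau> by (simp add: holo_triv_def)
  have "holo_transition A E ?\<sigma> \<tau>' \<and> holo_transition A E \<tau>' ?\<sigma>" if t: "\<tau>' \<in> trivs E" for \<tau>'
  proof -
    note lt' = trivs_local_triv[OF t]
    let ?U = "fst \<tau> \<inter> fst \<tau>'"
    have U: "open ?U" using open_local_triv[OF lt] open_local_triv[OF lt'] by blast
    have aU: "mholo A ?U (a i j)" if "i < k" "j \<in> {k..<?r}" for i j
      using mholo_subset[OF a[OF that]] by blast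
    have trans: "holo_transition A E \<tau> \<tau>'" "holo_transition A E \<tau>' \<tau>"
      using \<tau> t by (simp_all add: holo_triv_def)
    note holo_intros = mholo_sum[OF atlas U] mholo_mult[OF atlas U] mholo_add[OF atlas U] mholo_const[OF atlas U]
    have "mholo A ?U (\<lambda>q. snd \<tau>' q (triv_frame E ?\<sigma> m q) i)" if i: "i < ?r" and m: "m < ?r" for i m
    proof -
      let ?d = "\<lambda>i. if i = m then 1 else (0::complex)"
      have c: "mholo A ?U (\<lambda>q. unshear k ?r (\<lambda>i j. a i j q) ?d n)" for n
      proof (cases "n < k")
        case True
        have "mholo A ?U (\<lambda>q. ?d (?r - k + n) + (- 1) * (\<Sum>j=k..<?r. a n j q * ?d (j - k)))"
          by (intro holo_intros aU True)
        then show ?thesis using True by (simp add: unshear_def)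
      next
        case False
        then have "(\<lambda>q. unshear k ?r (\<lambda>i j. a i j q) ?d n) = (\<lambda>q. if n < ?r then ?d (n - k) else 0)"
          by (simp add: unshear_def)
        then show ?thesis using holo_intros(4) by simp
      qed
      have tj: "mholo A ?U (\<lambda>q. snd \<tau>' q (triv_frame E \<tau> j q) i)" if "j < ?r" for j
        using trans(1) i that by (simp add: holo_transition_def)
      have "mholo A ?U (\<lambda>q. \<Sum>j<?r. unshear k ?r (\<lambda>i j. a i j q) ?d j * snd \<tau>' q (triv_frame E \<tau> j q) i)"
        by (intro holo_intros c tj) simp
      then show ?thesis
      proof (rule mholo_cong[OF atlas U])
        fix q assume "q \<in> ?U"
        then have q: "q \<in> fst \<tau>" "q \<in> fst \<tau>'" "q \<in> fst ?\<sigma>" by (simp_all add: shear_triv_def)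
        show "(\<Sum>j<?r. unshear k ?r (\<lambda>i j. a i j q) ?d j * snd \<tau>' q (triv_frame E \<tau> j q) i) =
            snd \<tau>' q (triv_frame E ?\<sigma> m q) i"
          unfolding triv_change[OF lt lt' q(1,2) triv_frame_in_fibre[OF local_triv_shear[OF lt k] q(3) m]]
            triv_coord_shear_frame[OF lt k q(1) m] ..
      qed
    qed
    then have 1: "holo_transition A E ?\<sigma> \<tau>'"
      by (simp add: holo_transition_def shear_triv_def)
    have "mholo A ?U (\<lambda>q. snd ?\<sigma> q (triv_frame E \<tau>' m q) i)" if i: "i < ?r" and m: "m < ?r" for i m
    proof -
      have tj: "mholo A ?U (\<lambda>q. snd \<tau> q (triv_frame E \<tau>' m q) j)" if "j < ?r" for j
        using trans(2) m that by (simp add: holo_transition_def Int_commute)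
      show ?thesis
      proof (cases "i < ?r - k")
        case True
        then show ?thesis using tj[of "k + i"] by (simp add: shear_triv_def shear_def)
      next
        case False
        have "mholo A ?U (\<lambda>q. snd \<tau> q (triv_frame E \<tau>' m q) (i - (?r - k)) +
            (\<Sum>j=k..<?r. a (i - (?r - k)) j q * snd \<tau> q (triv_frame E \<tau>' m q) j))"
          using False i k by (intro holo_intros tj aU) auto
        then show ?thesis using False i by (simp add: shear_triv_def shear_def)
      qed
    qed
    then have 2: "holo_transition A E \<tau>' ?\<sigma>"
      by (simp add: holo_transition_def shear_triv_def Int_commute)
    show ?thesis using 1 2 ..
  qed
  then show ?thesis using local_triv_shear[OF lt k] by (simp add: holo_triv_def)
qed

end

context hermitian_bundle
begin

text \<open>Here \<open>(\<Sum>i<k. a i j e\<^sub>i)\<close> is the orthogonal projection of the frame section \<open>e\<^sub>j\<close> to the span of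
  \<open>e\<^sub>0, \<dots>, e\<^sub>k\<^sub>-\<^sub>1\<close>.\<close>

lemma orth_coefficients:
  assumes \<tau>: "holo_triv A E \<tau>" and k: "k \<le> bundle_rank E"
  obtains a where
    "\<And>i j. i < k \<Longrightarrow> j \<in> {k..<bundle_rank E} \<Longrightarrow> msmooth A (fst \<tau>) (a i j)"
    "\<And>q j l. q \<in> fst \<tau> \<Longrightarrow> j \<in> {k..<bundle_rank E} \<Longrightarrow> l < k \<Longrightarrow>
       h q (triv_frame E \<tau> j q - (\<Sum>i<k. scale E (a i j q) (triv_frame E \<tau> i q))) (triv_frame E \<tau> l q) = 0"
proof -
  have lt: "local_triv E \<tau>" using \<tau> by (simp add: holo_triv_def)
  have s: "smooth_section A E (fst \<tau>) (triv_frame E \<tau> j)" if "j < bundle_rank E" for j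
    by (rule holo_section_smooth[OF holo_section_triv_frame[OF \<tau> that]])
  let ?orth = "\<lambda>j a q l. h q (triv_frame E \<tau> j q - (\<Sum>i<k. scale E (a i q) (triv_frame E \<tau> i q)))
      (triv_frame E \<tau> l q) = 0"
  have "\<forall>j\<in>{k..<bundle_rank E}. \<exists>a. (\<forall>i<k. msmooth A (fst \<tau>) (a i)) \<and> (\<forall>q\<in>fst \<tau>. \<forall>l<k. ?orth j a q l)"
  proof
    fix j assume j: "j \<in> {k..<bundle_rank E}"
    show "\<exists>a. (\<forall>i<k. msmooth A (fst \<tau>) (a i)) \<and> (\<forall>q\<in>fst \<tau>. \<forall>l<k. ?orth j a q l)"
    proof (rule gram_schmidt[OF open_local_triv[OF lt]])
      show "c i = 0" if "q \<in> fst \<tau>" "(\<Sum>i<k. scale E (c i) (triv_frame E \<tau> i q)) = 0" "i < k" for q c i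
        by (rule triv_frame_independent[OF lt that(1) _ that(2)]) (use k that(3) in auto)
      show "smooth_section A E (fst \<tau>) (triv_frame E \<tau> i)" if "i < k" for i
        using k that by (intro s) simp
      show "smooth_section A E (fst \<tau>) (triv_frame E \<tau> j)" using j by (intro s) simp
    qed
  qed
  from bchoice[OF this] obtain a where
    "\<forall>j\<in>{k..<bundle_rank E}. (\<forall>i<k. msmooth A (fst \<tau>) (a j i)) \<and> (\<forall>q\<in>fst \<tau>. \<forall>l<k. ?orth j (a j) q l)" ..
  then show thesis by (intro that[of "\<lambda>i j. a j i"]) blast+
qed

context
  fixes S :: "'m \<Rightarrow> 'v set" and \<tau> k q b
  assumes sub: "S q \<subseteq> fibre E q" and lt: "local_triv E \<tau>" and q: "q \<in> fst \<tau>"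
    and adapted: "snd \<tau> q ` S q = coord_space k" and k: "k \<le> bundle_rank E"
    and b: "\<And>j l. j \<in> {k..<bundle_rank E} \<Longrightarrow> l < k \<Longrightarrow>
       h q (triv_frame E \<tau> j q - (\<Sum>i<k. scale E (b i j) (triv_frame E \<tau> i q))) (triv_frame E \<tau> l q) = 0"
begin

lemma orth_frame_mem:
  assumes j: "j \<in> {k..<bundle_rank E}"
  shows "triv_frame E \<tau> j q - (\<Sum>i<k. scale E (b i j) (triv_frame E \<tau> i q)) \<in> orth_compl E h S q"
  using j k by (intro orth_complI[where S = S and q = q and \<tau> = \<tau> and k = k, OF sub lt q adapted k] b
      subspace_diff[OF subspace_fibre] fibre_lincomb triv_frame_in_fibre[OF lt q]) auto

text \<open>The \<open>f\<^sub>j\<close> span the orthogonal complement: \<open>u\<close> is the combination of the \<open>f\<^sub>j\<close> with the components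
  of \<open>v\<close> as coefficients, and \<open>s = v - u\<close> has the components that \<open>shear\<close> puts last.\<close>

lemma adapted_splitting:
  assumes v: "v \<in> fibre E q"
  obtains s u where "s \<in> S q" "u \<in> orth_compl E h S q" "v = s + u"
    "\<And>i. i < k \<Longrightarrow> snd \<tau> q s i = snd \<tau> q v i + (\<Sum>j=k..<bundle_rank E. b i j * snd \<tau> q v j)"
proof -
  let ?r = "bundle_rank E"
  let ?e = "\<lambda>j. triv_frame E \<tau> j q"
  let ?f = "\<lambda>j. ?e j - (\<Sum>i<k. scale E (b i j) (?e i))"
  define u where "u = (\<Sum>j=k..<?r. scale E (snd \<tau> q v j) (?f j))"
  have u: "u \<in> orth_compl E h S q" unfolding u_def
    by (intro subspace_sum subspace_scale subspace_orth_compl orth_frame_mem sub)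
  then have uf: "u \<in> fibre E q" by (simp add: orth_compl_def)
  have coord_f: "snd \<tau> q (?f j) i = (if i = j then 1 else 0) - (if i < k then b i j else 0)"
    if "j \<in> {k..<?r}" for i j
  proof -
    have "snd \<tau> q (?f j) i = snd \<tau> q (?e j) i - snd \<tau> q (\<Sum>i<k. scale E (b i j) (?e i)) i"
      using that k by (intro triv_diff[OF lt q] fibre_lincomb triv_frame_in_fibre[OF lt q]) auto
    then show ?thesis
      using that k triv_coord_lincomb_frame[OF lt q, of "{..<k}" "\<lambda>i. b i j" i]
      by (simp add: triv_coord_frame[OF lt q])
  qed
  have coord_u: "snd \<tau> q u i = (\<Sum>j=k..<?r. snd \<tau> q v j * ((if i = j then 1 else 0) - (if i < k then b i j else 0)))"
    for i
  proof -
    have "snd \<tau> q u i = (\<Sum>j=k..<?r. snd \<tau> q v j * snd \<tau> q (?f j) i)"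
      unfolding u_def using k
      by (intro triv_lincomb[OF lt q] subspace_diff[OF subspace_fibre] fibre_lincomb triv_frame_in_fibre[OF lt q]) auto
    then show ?thesis by (simp add: coord_f)
  qed
  \<comment> \<open>The components of \<open>u\<close> from index \<open>k\<close> on are those of \<open>v\<close>, hence \<open>v - u\<close> lies in \<open>S q\<close>.\<close>
  have low: "snd \<tau> q u i = - (\<Sum>j=k..<?r. b i j * snd \<tau> q v j)" if "i < k" for i
    unfolding coord_u sum_negf[symmetric] by (intro sum.cong refl) (use that in auto)
  have high: "snd \<tau> q u i = snd \<tau> q v i" if "i \<ge> k" for i
  proof -
    have "snd \<tau> q u i = (\<Sum>j=k..<?r. if i = j then snd \<tau> q v j else 0)"
      unfolding coord_u by (intro sum.cong refl) (use that in auto)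
    also have "\<dots> = snd \<tau> q v i" using that triv_vanish[OF lt q v, of i] by simp
    finally show ?thesis .
  qed
  have vu: "v - u \<in> fibre E q" by (intro subspace_diff subspace_fibre v uf)
  show thesis
  proof
    show "v - u \<in> S q"
      using vu high by (simp add: mem_adapted_iff[where S = S and q = q and \<tau> = \<tau> and k = k, OF sub lt q adapted k]
          triv_diff[OF lt q v uf])
    show "snd \<tau> q (v - u) i = snd \<tau> q v i + (\<Sum>j=k..<?r. b i j * snd \<tau> q v j)" if "i < k" for i
      using that by (simp add: triv_diff[OF lt q v uf] low)
  qed (use u in auto)
qed

lemma mem_orth_compl_iff:
  assumes v: "v \<in> fibre E q"
  shows "v \<in> orth_compl E h S q \<longleftrightarrow>
    (\<forall>i<k. snd \<tau> q v i + (\<Sum>j=k..<bundle_rank E. b i j * snd \<tau> q v j) = 0)"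
proof -
  obtain s u where su: "s \<in> S q" "u \<in> orth_compl E h S q" "v = s + u"
    and c: "\<And>i. i < k \<Longrightarrow> snd \<tau> q s i = snd \<tau> q v i + (\<Sum>j=k..<bundle_rank E. b i j * snd \<tau> q v j)"
    using adapted_splitting[OF v] by blast
  have sf: "s \<in> fibre E q" using su(1) sub by blast
  have "v \<in> orth_compl E h S q \<longleftrightarrow> s = 0"
  proof
    assume "v \<in> orth_compl E h S q"
    then have "v - u \<in> orth_compl E h S q" by (intro subspace_diff subspace_orth_compl sub su(2))
    then show "s = 0" using su(1,3) orth_compl_disjoint[of s S q] by simp
  qed (use su in simp)
  also have "\<dots> \<longleftrightarrow> (\<forall>i<k. snd \<tau> q s i = 0)"
  proof
    assume "\<forall>i<k. snd \<tau> q s i = 0"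
    then show "s = 0"
      using adapted_expansion[where S = S and q = q and \<tau> = \<tau> and k = k, OF sub lt q adapted k su(1)] by simp
  qed (simp add: triv_zero[OF lt q])
  finally show ?thesis using c by simp
qed

lemma shear_triv_image_orth_compl:
  assumes a: "\<And>i j. b i j = a i j q"
  shows "snd (shear_triv E \<tau> k a) q ` orth_compl E h S q = coord_space (bundle_rank E - k)"
proof -
  let ?r = "bundle_rank E"
  let ?\<sigma> = "shear_triv E \<tau> k a"
  have coord: "v \<in> orth_compl E h S q \<longleftrightarrow> (\<forall>m\<ge>?r - k. snd ?\<sigma> q v m = 0)" if v: "v \<in> fibre E q" for v
  proof -
    have "(\<forall>m\<ge>?r - k. snd ?\<sigma> q v m = 0) \<longleftrightarrow> (\<forall>i<k. snd ?\<sigma> q v (?r - k + i) = 0)"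
    proof (intro iffI allI impI)
      fix m assume z: "\<forall>i<k. snd ?\<sigma> q v (?r - k + i) = 0" and m: "m \<ge> ?r - k"
      show "snd ?\<sigma> q v m = 0"
      proof (cases "m < ?r")
        case True
        then show ?thesis using z[rule_format, of "m - (?r - k)"] m k by simp
      qed (simp add: shear_triv_def shear_def)
    qed simp
    also have "\<dots> \<longleftrightarrow> (\<forall>i<k. snd \<tau> q v i + (\<Sum>j=k..<?r. b i j * snd \<tau> q v j) = 0)"
      using k by (auto simp: shear_triv_def shear_def a)
    finally show ?thesis using mem_orth_compl_iff[OF v] by simp
  qed
  have img: "snd ?\<sigma> q ` fibre E q = coord_space ?r"
    using triv_bij[OF local_triv_shear[OF lt k, of a], of q] q by (simp add: bij_betw_def shear_triv_def)
  show ?thesis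
  proof
    show "snd ?\<sigma> q ` orth_compl E h S q \<subseteq> coord_space (?r - k)"
      using coord by (auto simp: coord_space_def orth_compl_def)
    show "coord_space (?r - k) \<subseteq> snd ?\<sigma> q ` orth_compl E h S q"
    proof
      fix y assume y: "y \<in> coord_space (?r - k)"
      then have "y \<in> snd ?\<sigma> q ` fibre E q" unfolding img by (auto simp: coord_space_def)
      then obtain v where v: "v \<in> fibre E q" "y = snd ?\<sigma> q v" by blast
      with y coord[OF v(1)] show "y \<in> snd ?\<sigma> q ` orth_compl E h S q" by (simp add: coord_space_def)
    qed
  qed
qed

end

end

section \<open>Holomorphic subbundles\<close>

context holo_bundle
begin

lemma holo_subbundle_subset: "holo_subbundle A E S \<Longrightarrow> S p \<subseteq> fibre E p"
  by (simp add: holo_subbundle_def)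

lemma holo_subbundle_subspace: "holo_subbundle A E S \<Longrightarrow> subspace (S p)"
  by (simp add: holo_subbundle_def)

lemma holo_subbundle_adapted:
  assumes "holo_subbundle A E S"
  obtains k where "k \<le> bundle_rank E"
    "\<forall>p. \<exists>\<tau>. p \<in> fst \<tau> \<and> holo_triv A E \<tau> \<and> (\<forall>q\<in>fst \<tau>. snd \<tau> q ` S q = coord_space k)"
proof -
  from assms[unfolded holo_subbundle_def, THEN conjunct2] obtain k where k: "k \<le> bundle_rank E"
    "\<forall>p. \<exists>\<tau>. p \<in> fst \<tau> \<and> holo_triv A E \<tau> \<and> (\<forall>q\<in>fst \<tau>. snd \<tau> q ` S q = coord_space k)"
    by (elim exE conjE)
  show thesis by (rule that[OF k])
qed

lemma holo_triv_local_triv: "holo_triv A E \<tau> \<Longrightarrow> local_triv E \<tau>"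
  by (simp add: holo_triv_def)

end

lemma (in hermitian_bundle) fibre_splitting:
  assumes S: "holo_subbundle A E S" and v: "v \<in> fibre E p"
  obtains s u where "s \<in> S p" "u \<in> orth_compl E h S p" "v = s + u"
proof -
  obtain k where k: "k \<le> bundle_rank E"
    and ex: "\<forall>p. \<exists>\<tau>. p \<in> fst \<tau> \<and> holo_triv A E \<tau> \<and> (\<forall>q\<in>fst \<tau>. snd \<tau> q ` S q = coord_space k)"
    using holo_subbundle_adapted[OF S] .
  obtain \<tau> where \<tau>: "p \<in> fst \<tau>" "holo_triv A E \<tau>" "\<And>q. q \<in> fst \<tau> \<Longrightarrow> snd \<tau> q ` S q = coord_space k"
    using ex[THEN spec, of p] by blast
  obtain a where "\<And>i j. i < k \<Longrightarrow> j \<in> {k..<bundle_rank E} \<Longrightarrow> msmooth A (fst \<tau>) (a i j)"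
    and a: "\<And>q j l. q \<in> fst \<tau> \<Longrightarrow> j \<in> {k..<bundle_rank E} \<Longrightarrow> l < k \<Longrightarrow>
       h q (triv_frame E \<tau> j q - (\<Sum>i<k. scale E (a i j q) (triv_frame E \<tau> i q))) (triv_frame E \<tau> l q) = 0"
    using orth_coefficients[OF \<tau>(2) k] by blast
  show thesis
    by (rule adapted_splitting[where S = S and b = "\<lambda>i j. a i j p",
          OF holo_subbundle_subset[OF S] holo_triv_local_triv[OF \<tau>(2)] \<tau>(1) \<tau>(3)[OF \<tau>(1)] k a[OF \<tau>(1)] v])
       (assumption | rule that)+
qed

section \<open>The Chern connection and holomorphic complements\<close>

text \<open>A hermitian holomorphic vector bundle with its Chern connection \<open>D\<close>.\<close>

locale chern_bundle = hermitian_bundle A E h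
  for A :: "('m::topological_space, 'n::finite) chart set" and E :: "('m, 'v::ab_group_add) vbundle"
    and h :: "'m \<Rightarrow> 'v \<Rightarrow> 'v \<Rightarrow> complex" +
  fixes D :: "('m \<Rightarrow> 'v) \<Rightarrow> 'm \<Rightarrow> ('m, 'n) tvec \<Rightarrow> 'v"
  assumes chern: "chern_connection A E h D"
begin

lemmas D_connection = chern[unfolded chern_connection_def, THEN conjunct1, unfolded connection_def,
  THEN spec, THEN spec, THEN mp, THEN mp]

context
  fixes U \<xi> p X
  assumes U: "open U" and \<xi>: "smooth_section A E U \<xi>" and p: "p \<in> U" and X: "X \<in> tangent_space A p"
begin

lemma D_in_fibre: "D \<xi> p X \<in> fibre E p"
  by (rule D_connection[OF U \<xi>, THEN conjunct1, unfolded smooth_form1_def, THEN conjunct1, THEN bspec,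
        THEN bspec, THEN conjunct1, OF p X])

lemma D_add: "smooth_section A E U \<eta> \<Longrightarrow> D (\<lambda>q. \<xi> q + \<eta> q) p X = D \<xi> p X + D \<eta> p X"
  by (rule D_connection[OF U \<xi>, THEN conjunct2, THEN conjunct2, THEN conjunct1, THEN spec, THEN mp,
        THEN bspec, THEN bspec, OF _ p X])

lemma D_scale:
  "msmooth A U f \<Longrightarrow> D (\<lambda>q. scale E (f q) (\<xi> q)) p X = scale E (mdiff A f p X) (\<xi> p) + scale E (f p) (D \<xi> p X)"
  by (rule D_connection[OF U \<xi>, THEN conjunct2, THEN conjunct2, THEN conjunct2, THEN spec, THEN mp,
        THEN bspec, THEN bspec, OF _ p X])

lemma D_metric:
  "smooth_section A E U \<eta> \<Longrightarrow>
    mdiff A (\<lambda>q. h q (\<xi> q) (\<eta> q)) p X = h p (D \<xi> p X) (\<eta> p) + h p (\<xi> p) (D \<eta> p X)"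
  by (rule chern[unfolded chern_connection_def, THEN conjunct2, THEN conjunct2, THEN spec, THEN spec, THEN spec,
        THEN mp, THEN mp, THEN mp, THEN bspec, THEN bspec, OF U \<xi> _ p X])

lemma D_dbar: "scale E (1 / 2) (D \<xi> p X + scale E \<i> (D \<xi> p (tscale \<i> X))) = bundle_dbar A E \<xi> p X"
  by (rule chern[unfolded chern_connection_def, THEN conjunct2, THEN conjunct1, THEN spec, THEN spec,
        THEN mp, THEN mp, THEN bspec, THEN bspec, OF U \<xi> p X])

end

lemma D_lincomb:
  assumes U: "open U" and p: "p \<in> U" and X: "X \<in> tangent_space A p"
    and I: "finite I" and f: "\<And>i. i \<in> I \<Longrightarrow> msmooth A U (f i)" and \<xi>: "\<And>i. i \<in> I \<Longrightarrow> smooth_section A E U (\<xi> i)"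
  shows "D (\<lambda>q. \<Sum>i\<in>I. scale E (f i q) (\<xi> i q)) p X =
    (\<Sum>i\<in>I. scale E (mdiff A (f i) p X) (\<xi> i p) + scale E (f i p) (D (\<xi> i) p X))"
  using I f \<xi>
proof (induction I)
  case empty
  show ?case using D_add[OF U smooth_section_zero[OF U] p X smooth_section_zero[OF U]] by simp
next
  case (insert x F)
  have "D (\<lambda>q. scale E (f x q) (\<xi> x q) + (\<Sum>i\<in>F. scale E (f i q) (\<xi> i q))) p X =
      D (\<lambda>q. scale E (f x q) (\<xi> x q)) p X + D (\<lambda>q. \<Sum>i\<in>F. scale E (f i q) (\<xi> i q)) p X"
    using insert.prems by (intro D_add[OF U _ p X] smooth_section_scale smooth_section_lincomb U) auto
  then show ?case using insert by (simp add: D_scale[OF U _ p X])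
qed

text \<open>The derivative of a holomorphic section is of type \<open>(1,0)\<close>.\<close>

lemma D_holo_section:
  assumes U: "open U" and \<xi>: "holo_section A E U \<xi>" and p: "p \<in> U" and X: "X \<in> tangent_space A p"
  shows "D \<xi> p (tscale \<i> X) = scale E \<i> (D \<xi> p X)"
proof -
  have "D \<xi> p X + scale E \<i> (D \<xi> p (tscale \<i> X)) = 0"
    using D_dbar[OF U holo_section_smooth[OF \<xi>] p X] bundle_dbar_holo_section[OF \<xi> p] by simp
  then have "scale E \<i> (D \<xi> p X + scale E \<i> (D \<xi> p (tscale \<i> X))) = 0" by simp
  then show ?thesis by (simp add: scale_right_distrib)
qed

text \<open>In \<open>0 = d h(\<xi>, \<eta>) = h(D\<xi>, \<eta>) + h(\<xi>, D\<eta>)\<close> the first summand is complex linear and the second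
  one antilinear in the tangent vector, so both vanish.\<close>

lemma holo_orth_derivative:
  assumes U: "open U" and e: "holo_section A E U \<xi>" "holo_section A E U \<eta>"
    and o: "\<And>q. q \<in> U \<Longrightarrow> h q (\<xi> q) (\<eta> q) = 0" and p: "p \<in> U" and X: "X \<in> tangent_space A p"
  shows "h p (D \<xi> p X) (\<eta> p) = 0"
proof -
  note s = e[THEN holo_section_smooth]
  have JX: "tscale \<i> X \<in> tangent_space A p" by (rule tscale_i_in_tangent_space[OF atlas X])
  have fib: "\<xi> p \<in> fibre E p" "\<eta> p \<in> fibre E p" "D \<xi> p X \<in> fibre E p" "D \<eta> p X \<in> fibre E p"
    using s p D_in_fibre[OF U _ p X] by (auto simp: smooth_section_def)
  have eq: "h p (D \<xi> p Y) (\<eta> p) + h p (\<xi> p) (D \<eta> p Y) = 0" if Y: "Y \<in> tangent_space A p" for Y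
    using D_metric[OF U s(1) p Y s(2)] mdiff_eq_0[OF atlas U p o] by simp
  have "\<i> * h p (D \<xi> p X) (\<eta> p) - \<i> * h p (\<xi> p) (D \<eta> p X) = 0"
    using eq[OF JX] fib
    by (simp add: D_holo_section[OF U _ p X] e metric_scale_left metric_scale_right)
  then have "h p (D \<xi> p X) (\<eta> p) = h p (\<xi> p) (D \<eta> p X)" by simp
  with eq[OF X] show ?thesis by simp
qed

text \<open>Near \<open>p\<close> the complement has a holomorphic frame as well, to which the derivative of a holomorphic
  section of \<open>S\<close> is orthogonal by \<open>holo_orth_derivative\<close>; a vector orthogonal to the complement of \<open>S\<close>
  lies in \<open>S\<close>.\<close>

lemma D_frame_in_subbundle:
  assumes S: "holo_subbundle A E S" and S': "holo_subbundle A E (orth_compl E h S)"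
    and \<tau>: "holo_triv A E \<tau>" and adapted: "\<And>q. q \<in> fst \<tau> \<Longrightarrow> snd \<tau> q ` S q = coord_space k"
    and k: "k \<le> bundle_rank E" and i: "i < k" and p: "p \<in> fst \<tau>" and X: "X \<in> tangent_space A p"
  shows "D (triv_frame E \<tau> i) p X \<in> S p"
proof -
  let ?v = "D (triv_frame E \<tau> i) p X"
  note lt = holo_triv_local_triv[OF \<tau>]
  have i': "i < bundle_rank E" using i k by simp
  have vf: "?v \<in> fibre E p"
    by (rule D_in_fibre[OF open_local_triv[OF lt] holo_section_smooth[OF holo_section_triv_frame[OF \<tau> i']] p X])
  obtain k' where k': "k' \<le> bundle_rank E" and ex: "\<forall>p. \<exists>\<tau>. p \<in> fst \<tau> \<and> holo_triv A E \<tau> \<and>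
      (\<forall>q\<in>fst \<tau>. snd \<tau> q ` orth_compl E h S q = coord_space k')"
    using holo_subbundle_adapted[OF S'] .
  obtain \<sigma> where \<sigma>: "p \<in> fst \<sigma>" "holo_triv A E \<sigma>"
      "\<And>q. q \<in> fst \<sigma> \<Longrightarrow> snd \<sigma> q ` orth_compl E h S q = coord_space k'"
    using ex[THEN spec, of p] by blast
  note lt' = holo_triv_local_triv[OF \<sigma>(2)]
  let ?U = "fst \<tau> \<inter> fst \<sigma>"
  have U: "open ?U" using open_local_triv[OF lt] open_local_triv[OF lt'] by blast
  have "h p ?v (triv_frame E \<sigma> j p) = 0" if j: "j < k'" for j
  proof (rule holo_orth_derivative[OF U _ _ _ _ X])
    show "holo_section A E ?U (triv_frame E \<tau> i)"
      by (rule holo_section_subset[OF holo_section_triv_frame[OF \<tau> i']]) simp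
    show "holo_section A E ?U (triv_frame E \<sigma> j)"
      by (rule holo_section_subset[OF holo_section_triv_frame[OF \<sigma>(2)]]) (use j k' in simp_all)
    show "p \<in> ?U" using p \<sigma>(1) by simp
    fix q assume q: "q \<in> ?U"
    have e: "triv_frame E \<tau> i q \<in> S q"
      by (rule triv_frame_in_adapted[where S = S, OF holo_subbundle_subset[OF S] lt _ adapted k i]) (use q in simp_all)
    have f: "triv_frame E \<sigma> j q \<in> orth_compl E h S q"
      by (rule triv_frame_in_adapted[where S = "orth_compl E h S", OF holo_subbundle_subset[OF S'] lt' _ \<sigma>(3) k' j])
         (use q in simp_all)
    have "h q (triv_frame E \<sigma> j q) (triv_frame E \<tau> i q) = 0"
      using e f by (simp add: orth_compl_def)
    moreover have "triv_frame E \<sigma> j q \<in> fibre E q" "triv_frame E \<tau> i q \<in> fibre E q"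
      using e f holo_subbundle_subset[OF S] by (auto simp: orth_compl_def)
    ultimately show "h q (triv_frame E \<tau> i q) (triv_frame E \<sigma> j q) = 0"
      by (rule metric_eq_0_commute[rotated 2])
  qed
  then have o: "?v \<in> orth_compl E h (orth_compl E h S) p"
    by (intro orth_complI[where S = "orth_compl E h S", OF holo_subbundle_subset[OF S'] lt' \<sigma>(1) \<sigma>(3)[OF \<sigma>(1)] k' vf])
  obtain s u where su: "s \<in> S p" "u \<in> orth_compl E h S p" "?v = s + u"
    using fibre_splitting[OF S vf] .
  have sf: "s \<in> fibre E p" and uf: "u \<in> fibre E p"
    using su holo_subbundle_subset[OF S] by (auto simp: orth_compl_def)
  have "h p ?v u = 0" using o su(2) by (simp add: orth_compl_def)
  moreover have "h p s u = 0"
    by (rule metric_eq_0_commute[OF uf sf]) (use su in \<open>simp add: orth_compl_def\<close>)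
  ultimately have "h p u u = 0" using sf uf by (simp add: su(3) metric_add_left)
  then have "u = 0" using metric_self_eq_0 uf by blast
  then show ?thesis using su by simp
qed

text \<open>A metric connection that preserves a subbundle preserves its orthogonal complement.\<close>

lemma D_orth_compl:
  assumes S: "holo_subbundle A E S"
    and DS: "\<And>U \<xi> p X. open U \<Longrightarrow> smooth_section A E U \<xi> \<Longrightarrow> (\<And>q. q \<in> U \<Longrightarrow> \<xi> q \<in> S q) \<Longrightarrow> p \<in> U \<Longrightarrow>
      X \<in> tangent_space A p \<Longrightarrow> D \<xi> p X \<in> S p"
    and \<tau>: "holo_triv A E \<tau>" and adapted: "\<And>q. q \<in> fst \<tau> \<Longrightarrow> snd \<tau> q ` S q = coord_space k"
    and k: "k \<le> bundle_rank E" and \<eta>: "smooth_section A E (fst \<tau>) \<eta>"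
    and o: "\<And>q. q \<in> fst \<tau> \<Longrightarrow> \<eta> q \<in> orth_compl E h S q"
    and p: "p \<in> fst \<tau>" and X: "X \<in> tangent_space A p"
  shows "D \<eta> p X \<in> orth_compl E h S p"
proof -
  note lt = holo_triv_local_triv[OF \<tau>]
  note U = open_local_triv[OF lt]
  have Df: "D \<eta> p X \<in> fibre E p" by (rule D_in_fibre[OF U \<eta> p X])
  have "h p (D \<eta> p X) (triv_frame E \<tau> i p) = 0" if i: "i < k" for i
  proof -
    have s: "smooth_section A E (fst \<tau>) (triv_frame E \<tau> i)"
      by (rule holo_section_smooth[OF holo_section_triv_frame[OF \<tau>]]) (use i k in simp)
    have e: "triv_frame E \<tau> i q \<in> S q" if "q \<in> fst \<tau>" for q
      by (rule triv_frame_in_adapted[where S = S, OF holo_subbundle_subset[OF S] lt that adapted[OF that] k i])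
    have "mdiff A (\<lambda>q. h q (\<eta> q) (triv_frame E \<tau> i q)) p X = 0"
      by (rule mdiff_eq_0[OF atlas U p]) (use o e in \<open>simp add: orth_compl_def\<close>)
    moreover have "D (triv_frame E \<tau> i) p X \<in> S p"
      by (rule DS[OF U s e p X])
    then have "h p (\<eta> p) (D (triv_frame E \<tau> i) p X) = 0"
      using o[OF p] by (simp add: orth_compl_def)
    ultimately show ?thesis using D_metric[OF U \<eta> p X s] by simp
  qed
  then show ?thesis
    by (intro orth_complI[where S = S, OF holo_subbundle_subset[OF S] lt p adapted[OF p] k Df])
qed

text \<open>The connection is applied to \<open>e\<^sub>j = f\<^sub>j + (\<Sum>i<k. a i j e\<^sub>i)\<close>, where \<open>f\<^sub>j\<close> is a section of the
  complement. The \<open>(0,1)\<close>-part of the derivative vanishes on the left; on the right it is the sum of a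
  vector in the complement and of \<open>\<Sum>i<k. mdbar A (a i j) q X e\<^sub>i\<close> in \<open>S\<close>, so both vanish. Hence the
  \<open>a i j\<close> are holomorphic, and the \<open>f\<^sub>j\<close> form a holomorphic frame of the complement.\<close>

lemma holo_subbundle_orth_compl:
  assumes S: "holo_subbundle A E S"
    and DS: "\<And>U \<xi> p X. open U \<Longrightarrow> smooth_section A E U \<xi> \<Longrightarrow> (\<And>q. q \<in> U \<Longrightarrow> \<xi> q \<in> S q) \<Longrightarrow> p \<in> U \<Longrightarrow>
      X \<in> tangent_space A p \<Longrightarrow> D \<xi> p X \<in> S p"
  shows "holo_subbundle A E (orth_compl E h S)"
proof -
  let ?r = "bundle_rank E"
  obtain k where k: "k \<le> bundle_rank E"
    and ex: "\<forall>p. \<exists>\<tau>. p \<in> fst \<tau> \<and> holo_triv A E \<tau> \<and> (\<forall>q\<in>fst \<tau>. snd \<tau> q ` S q = coord_space k)"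
    using holo_subbundle_adapted[OF S] .
  have "\<exists>\<sigma>. p \<in> fst \<sigma> \<and> holo_triv A E \<sigma> \<and> (\<forall>q\<in>fst \<sigma>. snd \<sigma> q ` orth_compl E h S q = coord_space (?r - k))" for p
  proof -
    obtain \<tau> where p: "p \<in> fst \<tau>" and \<tau>: "holo_triv A E \<tau>"
      and adapted: "\<And>q. q \<in> fst \<tau> \<Longrightarrow> snd \<tau> q ` S q = coord_space k"
      using ex[THEN spec, of p] by blast
    note lt = holo_triv_local_triv[OF \<tau>]
    note U = open_local_triv[OF lt]
    let ?e = "triv_frame E \<tau>"
    obtain a where sa: "\<And>i j. i < k \<Longrightarrow> j \<in> {k..<?r} \<Longrightarrow> msmooth A (fst \<tau>) (a i j)"
      and a: "\<And>q j l. q \<in> fst \<tau> \<Longrightarrow> j \<in> {k..<?r} \<Longrightarrow> l < k \<Longrightarrow>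
         h q (?e j q - (\<Sum>i<k. scale E (a i j q) (?e i q))) (?e l q) = 0"
      using orth_coefficients[OF \<tau> k] by blast
    have he: "holo_section A E (fst \<tau>) (?e j)" if "j < ?r" for j
      by (rule holo_section_triv_frame[OF \<tau> that])
    have "mholo A (fst \<tau>) (a i j)" if i: "i < k" and j: "j \<in> {k..<?r}" for i j
    proof (rule mholo_if_mdbar_zero[OF atlas sa[OF i j] U])
      fix q X assume q: "q \<in> fst \<tau>" and X: "X \<in> tangent_space A q"
      have JX: "tscale \<i> X \<in> tangent_space A q" by (rule tscale_i_in_tangent_space[OF atlas X])
      define f where "f q = ?e j q - (\<Sum>i<k. scale E (a i j q) (?e i q))" for q
      have se: "smooth_section A E (fst \<tau>) (?e i)" if "i < k" for i
        using he k that by (intro holo_section_smooth) simp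
      have sej: "smooth_section A E (fst \<tau>) (?e j)"
        using he j by (intro holo_section_smooth) simp
      have sf: "smooth_section A E (fst \<tau>) f"
        unfolding f_def using se sej sa j by (intro smooth_section_diff_lincomb U) auto
      have fo: "f q \<in> orth_compl E h S q" if "q \<in> fst \<tau>" for q
        unfolding f_def
        by (rule orth_frame_mem[where S = S and b = "\<lambda>i j. a i j q",
              OF holo_subbundle_subset[OF S] lt that adapted[OF that] k a[OF that] j])
      have Dej: "D (?e j) q Y = D f q Y +
          (\<Sum>i<k. scale E (mdiff A (a i j) q Y) (?e i q) + scale E (a i j q) (D (?e i) q Y))"
        if Y: "Y \<in> tangent_space A q" for Y
      proof -
        have "?e j = (\<lambda>q. f q + (\<Sum>i<k. scale E (a i j q) (?e i q)))"
          by (simp add: f_def)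
        moreover have "D (\<lambda>q. f q + (\<Sum>i<k. scale E (a i j q) (?e i q))) q Y =
            D f q Y + D (\<lambda>q. \<Sum>i<k. scale E (a i j q) (?e i q)) q Y"
          using se sa j by (intro D_add[OF U sf q Y] smooth_section_lincomb U) auto
        moreover have "D (\<lambda>q. \<Sum>i<k. scale E (a i j q) (?e i q)) q Y =
          (\<Sum>i<k. scale E (mdiff A (a i j) q Y) (?e i q) + scale E (a i j q) (D (?e i) q Y))"
          using se sa j by (intro D_lincomb[OF U q Y]) auto
        ultimately show ?thesis by simp
      qed
      have dbar0: "D (?e i) q X + scale E \<i> (D (?e i) q (tscale \<i> X)) = 0" if "i < ?r" for i
        by (simp add: D_holo_section[OF U he[OF that] q X])
      \<comment> \<open>Twice the \<open>(0,1)\<close>-parts of \<open>D f\<close> and of the \<open>S\<close>-component.\<close>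
      let ?F = "D f q X + scale E \<i> (D f q (tscale \<i> X))"
      let ?G = "\<Sum>i<k. scale E (2 * mdbar A (a i j) q X) (?e i q)"
      have summand: "scale E (mdiff A (a i j) q X) (?e i q) + scale E (a i j q) (D (?e i) q X)
            + scale E \<i> (scale E (mdiff A (a i j) q (tscale \<i> X)) (?e i q) + scale E (a i j q) (D (?e i) q (tscale \<i> X)))
          = scale E (2 * mdbar A (a i j) q X) (?e i q)" if "i < k" for i
      proof -
        have "i < ?r" using that k by simp
        note D_holo_section[OF U he[OF this] q X]
        moreover have "2 * mdbar A (a i j) q X = mdiff A (a i j) q X + \<i> * mdiff A (a i j) q (tscale \<i> X)"
          by (simp add: mdbar_def)
        ultimately show ?thesis
          by (simp add: scale_right_distrib scale_left_distrib mult.left_commute mult.commute)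
      qed
      have "0 = D (?e j) q X + scale E \<i> (D (?e j) q (tscale \<i> X))" using dbar0 j by simp
      also have "\<dots> = ?F + (\<Sum>i<k. scale E (mdiff A (a i j) q X) (?e i q) + scale E (a i j q) (D (?e i) q X)
            + scale E \<i> (scale E (mdiff A (a i j) q (tscale \<i> X)) (?e i q) + scale E (a i j q) (D (?e i) q (tscale \<i> X))))"
        unfolding Dej[OF X] Dej[OF JX] sum.distrib[of _ "\<lambda>i. scale E \<i> (_ i)"] scale_sum_right[symmetric]
        by (simp only: scale_right_distrib[of \<i> "D f q (tscale \<i> X)"] ac_simps)
      also have "\<dots> = ?F + ?G" using summand by simp
      finally have FG: "?F + ?G = 0" by simp
      have F: "?F \<in> orth_compl E h S q"
        by (intro subspace_add subspace_scale subspace_orth_compl holo_subbundle_subset[OF S]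
            D_orth_compl[OF S DS \<tau> adapted k sf fo q] X JX)
      have G: "?G \<in> S q"
        by (intro subspace_sum subspace_scale holo_subbundle_subspace[OF S]
            triv_frame_in_adapted[where S = S, OF holo_subbundle_subset[OF S] lt q adapted[OF q] k]) simp
      have "?G = - ?F" by (rule minus_unique[OF FG, symmetric])
      then have "?G \<in> orth_compl E h S q"
        using subspace_neg[OF subspace_orth_compl[of S q, OF holo_subbundle_subset[OF S]] F] by (simp only:)
      then have "?G = 0" using orth_compl_disjoint[of ?G S q] G by blast
      then have "2 * mdbar A (a i j) q X = 0"
        using triv_frame_independent[OF lt q, of "{..<k}" "\<lambda>i. 2 * mdbar A (a i j) q X" i] i k by auto
      then show "mdbar A (a i j) q X = 0" by simp
    qed
    then have "holo_triv A E (shear_triv E \<tau> k a)" by (intro holo_triv_shear[OF \<tau> k])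
    moreover have "snd (shear_triv E \<tau> k a) q ` orth_compl E h S q = coord_space (?r - k)" if q: "q \<in> fst \<tau>" for q
      by (rule shear_triv_image_orth_compl[where S = S and a = a and q = q and b = "\<lambda>i j. a i j q",
            OF holo_subbundle_subset[OF S] lt q adapted[OF q] k a[OF q] refl])
    ultimately show ?thesis
      using p by (intro exI[of _ "shear_triv E \<tau> k a"]) (simp add: shear_triv_def)
  qed
  moreover have "orth_compl E h S p \<subseteq> fibre E p" "subspace (orth_compl E h S p)" for p
    using subspace_orth_compl[of S p, OF holo_subbundle_subset[OF S]] by (auto simp: orth_compl_def)
  ultimately show ?thesis
    unfolding holo_subbundle_def by (intro conjI allI exI[of _ "?r - k"]) simp_all
qed

end

section \<open>Vanishing of the second fundamental form\<close>

theorem corollary1: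
  fixes A :: "('m::t2_space, 'n::finite) chart set"
    and g :: "'m \<Rightarrow> ('m, 'n) tvec \<Rightarrow> ('m, 'n) tvec \<Rightarrow> real"
    and E :: "('m, 'v::ab_group_add) vbundle"
    and \<Phi> \<Phi>h :: "'m \<Rightarrow> ('m, 'n) tvec \<Rightarrow> 'v \<Rightarrow> 'v"
    and h :: "'m \<Rightarrow> 'v \<Rightarrow> 'v \<Rightarrow> complex"
    and Dh DhS :: "('m \<Rightarrow> 'v) \<Rightarrow> 'm \<Rightarrow> ('m, 'n) tvec \<Rightarrow> 'v"
    and S :: "'m \<Rightarrow> 'v set"
    and \<A>h :: "'m \<Rightarrow> ('m, 'n) tvec \<Rightarrow> 'v \<Rightarrow> 'v"
  assumes "compact_kaehler_manifold A g"
    and "hermitian_higgs_bundle A E \<Phi> h"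
    and "chern_connection A E h Dh"
    and "hermitian_conjugate A E h \<Phi> \<Phi>h"
    and "higgs_subbundle A E \<Phi> S"
    and "form_invariant A \<Phi>h S"
    and "second_fundamental_form A E h (hitchin_simpson Dh \<Phi> \<Phi>h) S DhS \<A>h"
  shows "(\<forall>p. \<forall>X\<in>tangent_space A p. \<forall>s\<in>S p. \<A>h p X s = 0) \<longleftrightarrow>
    higgs_orthogonal_decomposition A E \<Phi> h S (orth_compl E h S)"
proof -
  interpret chern_bundle A E h Dh
    using assms(1-3)
    by unfold_locales (simp_all add: compact_kaehler_manifold_def hermitian_higgs_bundle_def higgs_bundle_def)
  have S: "holo_subbundle A E S" and \<Phi>S: "form_invariant A \<Phi> S"
    using assms(5) by (simp_all add: higgs_subbundle_def)
  note sub = holo_subbundle_subset[OF S]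
  have hom\<Phi>: "hom_form1 A E (fibre E) (fibre E) \<Phi>"
    using assms(2) by (simp add: hermitian_higgs_bundle_def higgs_bundle_def)
  have \<Phi>_mem: "\<Phi> p X s \<in> S p" and \<Phi>h_mem: "\<Phi>h p X s \<in> S p"
    if "X \<in> tangent_space A p" "s \<in> S p" for p X s
    using \<Phi>S assms(6) that by (simp_all add: form_invariant_def)
  have \<Phi>_fibre: "\<Phi> p X v \<in> fibre E p" if "X \<in> tangent_space A p" "v \<in> fibre E p" for p X v
    by (rule hom\<Phi>[unfolded hom_form1_def, THEN conjunct1, THEN spec, THEN bspec, THEN bspec, THEN conjunct1, OF that])
  have conj: "h p (\<Phi>h p X v) w = h p v (\<Phi> p X w)"
    if "X \<in> tangent_space A p" "v \<in> fibre E p" "w \<in> fibre E p" for p X v w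
    by (rule assms(4)[unfolded hermitian_conjugate_def, THEN conjunct2, THEN conjunct2, THEN spec,
          THEN bspec, THEN bspec, THEN bspec, OF that])
  \<comment> \<open>\<open>\<Phi>\<close> preserves the complement because its adjoint preserves \<open>S\<close>.\<close>
  have \<Phi>_orth: "form_invariant A \<Phi> (orth_compl E h S)"
    unfolding form_invariant_def
  proof (intro allI ballI)
    fix p X v assume X: "X \<in> tangent_space A p" and v: "v \<in> orth_compl E h S p"
    then have vf: "v \<in> fibre E p" by (simp add: orth_compl_def)
    have "h p (\<Phi> p X v) s = 0" if s: "s \<in> S p" for s
    proof -
      have sf: "s \<in> fibre E p" and \<Phi>s: "\<Phi>h p X s \<in> fibre E p"
        using sub s \<Phi>h_mem[OF X s] by auto
      have "h p v (\<Phi>h p X s) = 0" using v \<Phi>h_mem[OF X s] by (simp add: orth_compl_def)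
      then have "h p (\<Phi>h p X s) v = 0" by (rule metric_eq_0_commute[OF vf \<Phi>s])
      then have "h p s (\<Phi> p X v) = 0" using conj[OF X sf vf] by simp
      then show ?thesis by (rule metric_eq_0_commute[OF sf \<Phi>_fibre[OF X vf]])
    qed
    then show "\<Phi> p X v \<in> orth_compl E h S p" using \<Phi>_fibre[OF X vf] by (simp add: orth_compl_def)
  qed
  note hom\<A> = assms(7)[unfolded second_fundamental_form_def, THEN conjunct1, unfolded hom_form1_def,
      THEN conjunct1, THEN spec, THEN bspec, THEN bspec]
  note split = assms(7)[unfolded second_fundamental_form_def, THEN conjunct2, THEN spec, THEN spec,
      THEN mp, THEN mp, THEN mp, THEN conjunct2, THEN bspec, THEN bspec]
  have Dh_eq: "Dh \<xi> p X + (\<Phi> p X (\<xi> p) + \<Phi>h p X (\<xi> p)) = DhS \<xi> p X + \<A>h p X (\<xi> p)"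
    and DhS_mem: "DhS \<xi> p X \<in> S p"
    if "open U" "smooth_section A E U \<xi>" "\<And>q. q \<in> U \<Longrightarrow> \<xi> q \<in> S q" "p \<in> U" "X \<in> tangent_space A p"
    for U \<xi> p X
  proof -
    have "\<forall>q\<in>U. \<xi> q \<in> S q" using that(3) by blast
    from split[OF that(1,2) this that(4,5)]
    show "Dh \<xi> p X + (\<Phi> p X (\<xi> p) + \<Phi>h p X (\<xi> p)) = DhS \<xi> p X + \<A>h p X (\<xi> p)" "DhS \<xi> p X \<in> S p"
      by (simp_all add: hitchin_simpson_def add.assoc)
  qed
  show ?thesis
  proof
    assume zero: "\<forall>p. \<forall>X\<in>tangent_space A p. \<forall>s\<in>S p. \<A>h p X s = 0"
    have "Dh \<xi> p X \<in> S p"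
      if U: "open U" "smooth_section A E U \<xi>" "\<And>q. q \<in> U \<Longrightarrow> \<xi> q \<in> S q" "p \<in> U" "X \<in> tangent_space A p"
      for U \<xi> p X
    proof -
      have "Dh \<xi> p X = DhS \<xi> p X - (\<Phi> p X (\<xi> p) + \<Phi>h p X (\<xi> p))"
        using Dh_eq[OF U] zero U(3)[OF U(4)] U(5) by (simp add: eq_diff_eq)
      then show ?thesis
        using DhS_mem[OF U] \<Phi>_mem[OF U(5) U(3)[OF U(4)]] \<Phi>h_mem[OF U(5) U(3)[OF U(4)]]
        by (simp add: subspace_diff subspace_add holo_subbundle_subspace[OF S])
    qed
    then have S': "holo_subbundle A E (orth_compl E h S)"
      by (rule holo_subbundle_orth_compl[OF S])
    show "higgs_orthogonal_decomposition A E \<Phi> h S (orth_compl E h S)"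
      unfolding higgs_orthogonal_decomposition_def higgs_subbundle_def
    proof (intro conjI allI ballI S S' \<Phi>S \<Phi>_orth)
      fix p
      show "fibre E p = {s + s' |s s'. s \<in> S p \<and> s' \<in> orth_compl E h S p}"
      proof (intro subset_antisym subsetI)
        fix v assume "v \<in> fibre E p"
        then obtain s u where "s \<in> S p" "u \<in> orth_compl E h S p" "v = s + u"
          by (rule fibre_splitting[OF S])
        then show "v \<in> {s + s' |s s'. s \<in> S p \<and> s' \<in> orth_compl E h S p}" by blast
      next
        fix v assume "v \<in> {s + s' |s s'. s \<in> S p \<and> s' \<in> orth_compl E h S p}"
        then obtain s u where "s \<in> fibre E p" "u \<in> fibre E p" "v = s + u"
          using sub by (auto simp: orth_compl_def)
        then show "v \<in> fibre E p" by (simp add: subspace_add[OF subspace_fibre])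
      qed
      show "S p \<inter> orth_compl E h S p = {0}"
        using orth_compl_disjoint[of _ S p] subspace_0[OF holo_subbundle_subspace[OF S, of p]]
          subspace_0[OF subspace_orth_compl[of S p, OF sub]] by blast
      fix s s' assume s: "s \<in> S p" "s' \<in> orth_compl E h S p"
      then have "s \<in> fibre E p" "s' \<in> fibre E p" "h p s' s = 0" using sub by (auto simp: orth_compl_def)
      then show "h p s s' = 0" using metric_eq_0_commute by blast
    qed
  next
    assume "higgs_orthogonal_decomposition A E \<Phi> h S (orth_compl E h S)"
    then have S': "holo_subbundle A E (orth_compl E h S)"
      by (simp add: higgs_orthogonal_decomposition_def higgs_subbundle_def)
    obtain k where k: "k \<le> bundle_rank E"
      and ex: "\<forall>p. \<exists>\<tau>. p \<in> fst \<tau> \<and> holo_triv A E \<tau> \<and> (\<forall>q\<in>fst \<tau>. snd \<tau> q ` S q = coord_space k)"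
      using holo_subbundle_adapted[OF S] .
    show "\<forall>p. \<forall>X\<in>tangent_space A p. \<forall>s\<in>S p. \<A>h p X s = 0"
    proof (intro allI ballI)
      fix p X s assume X: "X \<in> tangent_space A p" and s: "s \<in> S p"
      obtain \<tau> where p: "p \<in> fst \<tau>" and \<tau>: "holo_triv A E \<tau>"
        and adapted: "\<And>q. q \<in> fst \<tau> \<Longrightarrow> snd \<tau> q ` S q = coord_space k"
        using ex[THEN spec, of p] by blast
      note lt = holo_triv_local_triv[OF \<tau>]
      define \<A> where "\<A> = \<A>h p X"
      have add: "\<A> (v + w) = \<A> v + \<A> w" if "v \<in> S p" "w \<in> S p" for v w
        unfolding \<A>_def by (rule hom\<A>[THEN conjunct2, THEN conjunct1, THEN bspec, OF X that])
      have sc: "\<A> (scale E c v) = scale E c (\<A> v)" if "v \<in> S p" for c v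
        unfolding \<A>_def by (rule hom\<A>[THEN conjunct2, THEN conjunct2, THEN conjunct1, THEN spec, OF X that])
      have orth: "\<A> v \<in> orth_compl E h S p" if "v \<in> S p" for v
        unfolding \<A>_def by (rule hom\<A>[THEN conjunct1, OF X that])
      have e: "triv_frame E \<tau> i q \<in> S q" if "i < k" "q \<in> fst \<tau>" for i q
        by (rule triv_frame_in_adapted[where S = S, OF sub lt that(2) adapted[OF that(2)] k that(1)])
      \<comment> \<open>On a frame section \<open>e\<close> of \<open>S\<close> all the terms of \<open>\<A> e = Dh e + \<Phi> e + \<Phi>h e - DhS e\<close> lie in \<open>S\<close>.\<close>
      have frame: "\<A> (triv_frame E \<tau> i p) = 0" if i: "i < k" for i
      proof (rule orth_compl_disjoint[OF _ orth[OF e[OF i p]]])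
        have "smooth_section A E (fst \<tau>) (triv_frame E \<tau> i)"
          using i k by (intro holo_section_smooth holo_section_triv_frame[OF \<tau>]) simp
        note \<xi> = open_local_triv[OF lt] this e[OF i] p X
        have "\<A> (triv_frame E \<tau> i p) = Dh (triv_frame E \<tau> i) p X +
            (\<Phi> p X (triv_frame E \<tau> i p) + \<Phi>h p X (triv_frame E \<tau> i p)) - DhS (triv_frame E \<tau> i) p X"
          using Dh_eq[OF \<xi>] by (simp add: \<A>_def eq_diff_eq add.commute)
        then show "\<A> (triv_frame E \<tau> i p) \<in> S p"
          using D_frame_in_subbundle[OF S S' \<tau> adapted k i p X] DhS_mem[OF \<xi>]
            \<Phi>_mem[OF X e[OF i p]] \<Phi>h_mem[OF X e[OF i p]]
          by (simp add: subspace_diff subspace_add holo_subbundle_subspace[OF S])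
      qed
      have "\<A> (\<Sum>i\<in>I. scale E (c i) (triv_frame E \<tau> i p)) = 0 \<and>
          (\<Sum>i\<in>I. scale E (c i) (triv_frame E \<tau> i p)) \<in> S p" if "finite I" "I \<subseteq> {..<k}" for I c
        using that
      proof (induction I)
        case empty
        have 0: "0 \<in> S p" by (rule subspace_0[OF holo_subbundle_subspace[OF S]])
        then show ?case using sc[OF 0, of 0] by simp
      next
        case (insert x I)
        have "scale E (c x) (triv_frame E \<tau> x p) \<in> S p"
          using insert.prems e[of x p] p by (intro subspace_scale holo_subbundle_subspace[OF S]) auto
        then show ?case using insert frame[of x] e[of x p] p
          by (simp add: add sc subspace_add holo_subbundle_subspace[OF S])
      qed
      from this[of "{..<k}" "snd \<tau> p s"]
      show "\<A>h p X s = 0"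
        using adapted_expansion[where S = S, OF sub lt p adapted[OF p] k s] by (simp add: \<A>_def)
    qed
  qed
qed

end
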